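(* Let $L$ be an atomic lattice with set of atoms $E$ and let $\mathcal G$ be a building set in $L$. Let $\Gamma$ be a lightcone refinement of $\Sigma^{2\mathcal G}$. Then $C\mapsto p(\Delta_0^{-1}(C))$ induces a bijection between the maximal cones of $\Gamma$ and the maximal cones of $p(\Delta_0^{-1}\Gamma)$. The same is true if $\Gamma$ is a lightcone refinement of $\mathcal U_{\mathcal G}$.
   Context: All lattices are finite. Let $L$ be a lattice with minimum $\hat 0$ and maximum $\hat 1$. $L$ is atomic if every element is the join of the atoms below it; $f\in L$ is identified with the set of atoms $e\le f$. A building set is a subset $\mathcal G\subseteq L_{>\hat 0}$ with $\hat 1\in\mathcal G$ such that for every $f\in L_{>\hat 0}\setminus\mathcal G$, the interval $[\hat 0,f]$ is the product lattice $[\hat 0,g_1]\times\dots\times[\hat 0,g_k]$ (via join), $g_1,\dots,g_k$ being the maximal elements of $\mathcal G$ below $f$. A subset $N\subseteq\mathcal G$ is nested if for all $k\ge2$ and pairwise incomparable $f_1,\dots,f_k\in N$, $f_1\vee\dots\vee f_k\notin\mathcal G$; $\mathcal N(L,\mathcal G)$ is the complex of nested sets. For nested $N$, $f\wedge g=\hat 0$ for incomparable $f,g\in N$. $\mathbb R^{\mathcal G}$ has basis $\mathcal G$. $\mathbb R^{2\mathcal G}$ has basis $f^+,f^-$ ($f\in\mathcal G$), with dual coordinates $p_f,m_f$. For nested $N$, $\mathbb R_+^{2N}$ is the cone spanned by $f^\pm$, $f\in N$. $\Sigma^{2\mathcal G}$ is the fan of all faces of the cones $\mathbb R_+^{2N}$.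 The causal cone is $\{m_{\hat 1}=0,\ p_g,m_g,F_g\ge0\ \forall g\in\mathcal G\}$ with $F_g:=p_{\hat 1}+\sum_{f\in\mathcal G,\,g<f<\hat 1}(p_f-m_f)-m_g$; the universe fan $\mathcal U_{\mathcal G}$ consists of the intersections of cones of $\Sigma^{2\mathcal G}$ with the causal cone, and all faces. Maps: $\Delta_0:\mathbb R^{\mathcal G}\to\mathbb R^{2\mathcal G}$ is linear with $\hat 1\mapsto\hat 1^+$ and $g\mapsto g^++g^-$ for $g\ne\hat 1$; $p:\mathbb R^{\mathcal G}\to\mathbb R^E$, $f\mapsto\sum_{e\in f}e$. For a fan $\Gamma$ in $\mathbb R^{2\mathcal G}$, $p(\Delta_0^{-1}\Gamma)$ is the collection of cones $p(\Delta_0^{-1}(C))$, $C\in\Gamma$. Lightcone refinements: for a nested set $N$, let $\overline T_N$ be the rooted tree obtained from the Hasse diagram of $N$ by adjoining a root above all maximal elements; its edges, labelled by their lower endpoints, are identified with $N$. A Boolean building set on $N$ is a collection of nonempty subsets of $N$ containing all singletons and closed under unions of intersecting members. Put $\lambda_e:=\sum_{f\in N,\,f>e}p_f+\sum_{f\in N,\ f<e\text{ or }f\wedge e=\hat 0}m_f$ for $e\in N$. The lightcone subdivision of $\mathbb R_+^{2N}$ associated to $\mathcal B_N$ is given by the domains of linearity of $\sum_{t\in\mathcal B_N}\min_{e\in t}\lambda_e$ on $\mathbb R_+^{2N}$. Choose for each nested set $N$ a Boolean building set $\mathcal B_N$ on $N$ such that each $t\in\mathcal B_N$ is the edge set of a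 connected subgraph of $\overline T_N$ and, for $N'\subseteq N$, $\mathcal B_{N'}$ consists of the nonempty sets $t\cap N'$, $t\in\mathcal B_N$. The associated lightcone subdivisions assemble into a fan in $\mathbb R^{2\mathcal G}$, a lightcone refinement of $\Sigma^{2\mathcal G}$; its subfan of cones contained in the support of $\mathcal U_{\mathcal G}$ refines $\mathcal U_{\mathcal G}$ and is called a lightcone refinement of $\mathcal U_{\mathcal G}$.
   Formalization: For the universe fan, that the subfan of cones in its support refines it is required as a condition rather than assumed automatic: it fails, and so does the bijection, if all Boolean building sets consist of singletons only; it holds whenever each nonempty N belongs to its Boolean building set. *)

theory Defs
  imports "HOL-Analysis.Analysis"
begin

section \<open>Lattices, building sets, nested sets\<close>

text \<open>
  A finite lattice is a type of sort \<open>{finite, complete_lattice}\<close> (every nonempty finite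
  lattice is complete).  Its minimum and maximum are \<open>bot\<close> and \<open>top\<close>.
\<close>

definition maximal_elements :: "'b::order set \<Rightarrow> 'b set" where
  "maximal_elements S = {x \<in> S. \<forall>y\<in>S. x \<le> y \<longrightarrow> y = x}"

definition atoms :: "'a::{finite,complete_lattice} set" where
  "atoms = {e. e \<noteq> bot \<and> (\<forall>x. x \<le> e \<longrightarrow> x = bot \<or> x = e)}"

definition atoms_below :: "'a::{finite,complete_lattice} \<Rightarrow> 'a set" where
  "atoms_below f = {e \<in> atoms. e \<le> f}"

definition atomic_lattice :: "'a::{finite,complete_lattice} itself \<Rightarrow> bool" where
  "atomic_lattice _ \<longleftrightarrow> (\<forall>f::'a. Sup (atoms_below f) = f)"

text \<open>
  The interval below \<open>f\<close> is the product of the intervals below the elements of \<open>M\<close>: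
  taking joins is an isomorphism of ordered sets, hence of lattices.
\<close>

definition join_product :: "'a::{finite,complete_lattice} set \<Rightarrow> 'a \<Rightarrow> bool" where
  "join_product M f \<longleftrightarrow>
     bij_betw (\<lambda>x. SUP g\<in>M. x g) (\<Pi>\<^sub>E g\<in>M. {bot..g}) {bot..f} \<and>
     (\<forall>x \<in> (\<Pi>\<^sub>E g\<in>M. {bot..g}). \<forall>y \<in> (\<Pi>\<^sub>E g\<in>M. {bot..g}).
        (SUP g\<in>M. x g) \<le> (SUP g\<in>M. y g) \<longleftrightarrow> (\<forall>g\<in>M. x g \<le> y g))"

definition building_set :: "'a::{finite,complete_lattice} set \<Rightarrow> bool" where
  "building_set G \<longleftrightarrow> bot \<notin> G \<and> top \<in> G \<and>
     (\<forall>f. f \<noteq> bot \<and> f \<notin> G \<longrightarrow> join_product (maximal_elements {g \<in> G. g \<le> f}) f)"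

definition nested :: "'a::{finite,complete_lattice} set \<Rightarrow> 'a set \<Rightarrow> bool" where
  "nested G N \<longleftrightarrow> N \<subseteq> G \<and>
     (\<forall>A \<subseteq> N. 2 \<le> card A \<and> pairwise (\<lambda>f g. \<not> f \<le> g \<and> \<not> g \<le> f) A \<longrightarrow> Sup A \<notin> G)"

section \<open>The ambient spaces and the universe fan\<close>

text \<open>
  \<open>\<real>\<^sup>G\<close> and \<open>\<real>\<^sup>E\<close> are realised as the coordinate subspaces of \<^typ>\<open>real ^ 'a\<close> belonging
  to \<open>G\<close> and to the set of atoms, and the doubled space of \<open>G\<close> as a subspace of
  \<^typ>\<open>(real ^ 'a) \<times> (real ^ 'a)\<close>, the first component carrying the basis vectors
  \<open>f\<^sup>+\<close> and the second one the basis vectors \<open>f\<^sup>-\<close>.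
\<close>

type_synonym 'a coords = "(real, 'a) vec"
type_synonym 'a doubled = "(real, 'a) vec \<times> (real, 'a) vec"

definition coord_space :: "'a::{finite,complete_lattice} set \<Rightarrow> 'a coords set" where
  "coord_space G = {x. \<forall>f. f \<notin> G \<longrightarrow> x $ f = 0}"

definition plus_vec :: "'a::{finite,complete_lattice} \<Rightarrow> 'a doubled" where
  "plus_vec f = (axis f 1, 0)"

definition minus_vec :: "'a::{finite,complete_lattice} \<Rightarrow> 'a doubled" where
  "minus_vec f = (0, axis f 1)"

definition pco :: "'a::{finite,complete_lattice} \<Rightarrow> 'a doubled \<Rightarrow> real" where
  "pco f v = fst v $ f"

definition mco :: "'a::{finite,complete_lattice} \<Rightarrow> 'a doubled \<Rightarrow> real" where
  "mco f v = snd v $ f"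

definition nested_cone :: "'a::{finite,complete_lattice} set \<Rightarrow> 'a doubled set" where
  "nested_cone N = convex_cone hull (plus_vec ` N \<union> minus_vec ` N)"

text \<open>
  In \<^const>\<open>face_of\<close> the empty set is a face of every convex set; it is not a cone.
\<close>

definition all_faces :: "'v::real_vector set set \<Rightarrow> 'v set set" where
  "all_faces \<C> = {F. F \<noteq> {} \<and> (\<exists>C\<in>\<C>. F face_of C)}"

definition Sigma_fan :: "'a::{finite,complete_lattice} set \<Rightarrow> 'a doubled set set" where
  "Sigma_fan G = all_faces (nested_cone ` {N. nested G N})"

definition causal_form ::
    "'a::{finite,complete_lattice} set \<Rightarrow> 'a \<Rightarrow> 'a doubled \<Rightarrow> real" where
  "causal_form G g v = pco top v + (\<Sum>f\<in>{f\<in>G. g < f \<and> f < top}. pco f v - mco f v) - mco g v"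

definition causal_cone :: "'a::{finite,complete_lattice} set \<Rightarrow> 'a doubled set" where
  "causal_cone G = {v \<in> coord_space G \<times> coord_space G. mco top v = 0 \<and>
     (\<forall>g\<in>G. 0 \<le> pco g v \<and> 0 \<le> mco g v \<and> 0 \<le> causal_form G g v)}"

definition universe_fan :: "'a::{finite,complete_lattice} set \<Rightarrow> 'a doubled set set" where
  "universe_fan G = all_faces ((\<lambda>C. C \<inter> causal_cone G) ` Sigma_fan G)"

section \<open>The maps\<close>

definition Delta0 ::
    "'a::{finite,complete_lattice} set \<Rightarrow> 'a coords \<Rightarrow> 'a doubled" where
  "Delta0 G x = (\<Sum>g\<in>G. x $ g *\<^sub>R (if g = top then plus_vec top else plus_vec g + minus_vec g))"

definition atom_map :: "'a::{finite,complete_lattice} set \<Rightarrow> 'a coords \<Rightarrow> 'a coords" where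
  "atom_map G x = (\<Sum>f\<in>G. x $ f *\<^sub>R (\<Sum>e\<in>atoms_below f. axis e 1))"

definition proj_cone ::
    "'a::{finite,complete_lattice} set \<Rightarrow> 'a doubled set \<Rightarrow> 'a coords set" where
  "proj_cone G C = atom_map G ` {x \<in> coord_space G. Delta0 G x \<in> C}"

section \<open>Lightcone refinements\<close>

text \<open>
  The tree has vertex set \<open>N\<close> (as \<open>Some f\<close>) together with the root \<open>None\<close>.
  The edge labelled \<open>e\<close> joins \<open>Some e\<close> to the vertices covering it; for nested \<open>N\<close> there is
  exactly one of these.
\<close>

definition tree_covers :: "'a::{finite,complete_lattice} set \<Rightarrow> 'a \<Rightarrow> 'a option set" where
  "tree_covers N e =
     Some ` {f \<in> N. e < f \<and> \<not> (\<exists>g\<in>N. e < g \<and> g < f)} \<union>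
     (if e \<in> maximal_elements N then {None} else {})"

definition tree_edge :: "'a::{finite,complete_lattice} set \<Rightarrow> 'a \<Rightarrow> 'a option set" where
  "tree_edge N e = insert (Some e) (tree_covers N e)"

definition connected_edge_set :: "'a::{finite,complete_lattice} set \<Rightarrow> 'a set \<Rightarrow> bool" where
  "connected_edge_set N t \<longleftrightarrow>
     (\<forall>u \<in> \<Union> (tree_edge N ` t). \<forall>v \<in> \<Union> (tree_edge N ` t).
        (u, v) \<in> {(a, b). \<exists>e\<in>t. a \<in> tree_edge N e \<and> b \<in> tree_edge N e}\<^sup>*)"

definition boolean_building_set :: "'b set \<Rightarrow> 'b set set \<Rightarrow> bool" where
  "boolean_building_set N \<B> \<longleftrightarrow>
     (\<forall>t\<in>\<B>. t \<noteq> {} \<and> t \<subseteq> N) \<and>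
     (\<forall>e\<in>N. {e} \<in> \<B>) \<and>
     (\<forall>s\<in>\<B>. \<forall>t\<in>\<B>. s \<inter> t \<noteq> {} \<longrightarrow> s \<union> t \<in> \<B>)"

definition lambda_form ::
    "'a::{finite,complete_lattice} set \<Rightarrow> 'a \<Rightarrow> 'a doubled \<Rightarrow> real" where
  "lambda_form N e v =
     (\<Sum>f\<in>{f\<in>N. e < f}. pco f v) + (\<Sum>f\<in>{f\<in>N. f < e \<or> inf f e = bot}. mco f v)"

definition lightcone_function ::
    "'a::{finite,complete_lattice} set \<Rightarrow> 'a set set \<Rightarrow> 'a doubled \<Rightarrow> real" where
  "lightcone_function N \<B> v = (\<Sum>t\<in>\<B>. Min ((\<lambda>e. lambda_form N e v) ` t))"

text \<open>
  Domains of linearity of a piecewise linear function on a convex cone \<open>K\<close>: the maximal convex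
  subsets of \<open>K\<close> on which it agrees with a linear function.
\<close>

definition linearity_domains :: "('v::real_vector \<Rightarrow> real) \<Rightarrow> 'v set \<Rightarrow> 'v set set" where
  "linearity_domains \<phi> K =
     maximal_elements {D. D \<subseteq> K \<and> convex D \<and> (\<exists>l. linear l \<and> (\<forall>v\<in>D. \<phi> v = l v))}"

definition lightcone_subdivision ::
    "'a::{finite,complete_lattice} set \<Rightarrow> 'a set set \<Rightarrow> 'a doubled set set" where
  "lightcone_subdivision N \<B> =
     all_faces (linearity_domains (lightcone_function N \<B>) (nested_cone N))"

definition lightcone_choice :: "'a::{finite,complete_lattice} set \<Rightarrow> ('a set \<Rightarrow> 'a set set) \<Rightarrow> bool" where
  "lightcone_choice G B \<longleftrightarrow>
     (\<forall>N. nested G N \<longrightarrow>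
        boolean_building_set N (B N) \<and>
        (\<forall>t\<in>B N. connected_edge_set N t) \<and>
        (\<forall>N' \<subseteq> N. B N' = {t \<inter> N' |t. t \<in> B N \<and> t \<inter> N' \<noteq> {}}))"

definition lightcone_fan ::
    "'a::{finite,complete_lattice} set \<Rightarrow> ('a set \<Rightarrow> 'a set set) \<Rightarrow> 'a doubled set set" where
  "lightcone_fan G B = (\<Union>N\<in>{N. nested G N}. lightcone_subdivision N (B N))"

definition lightcone_refinement_Sigma ::
    "'a::{finite,complete_lattice} set \<Rightarrow> 'a doubled set set \<Rightarrow> bool" where
  "lightcone_refinement_Sigma G \<Gamma> \<longleftrightarrow> (\<exists>B. lightcone_choice G B \<and> \<Gamma> = lightcone_fan G B)"

definition refines :: "'v set set \<Rightarrow> 'v set set \<Rightarrow> bool" where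
  "refines \<Gamma> \<Delta> \<longleftrightarrow> \<Union>\<Gamma> = \<Union>\<Delta> \<and> (\<forall>C\<in>\<Gamma>. \<exists>D\<in>\<Delta>. C \<subseteq> D)"

text \<open>
  The requirement that the subfan refines the universe fan restricts the choice of the Boolean
  building sets: it amounts to \<open>N \<in> B N\<close> for all nonempty nested \<open>N\<close>.  If for instance all
  \<open>B N\<close> consist of singletons only, the lightcone subdivisions are trivial, and in general
  the cones they contribute do not cover the support of the universe fan.
\<close>

definition lightcone_refinement_universe ::
    "'a::{finite,complete_lattice} set \<Rightarrow> 'a doubled set set \<Rightarrow> bool" where
  "lightcone_refinement_universe G \<Gamma> \<longleftrightarrow>
     (\<exists>\<Gamma>'. lightcone_refinement_Sigma G \<Gamma>' \<and> \<Gamma> = {C \<in> \<Gamma>'. C \<subseteq> \<Union>(universe_fan G)} \<and>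
       refines \<Gamma> (universe_fan G))"

end

theory Submission
  imports Defs
begin

text \<open>
  On the diagonal \<open>\<Delta>\<^sub>0\<close> every \<open>\<lambda>\<^sub>e\<close> with \<open>e \<in> N\<close> is the sum of all coordinates minus the
  coordinate at \<open>e\<close> (\<open>lambda_form_ranking\<close>).  The diagonal therefore meets every possible
  ordering of the forms \<open>\<lambda>\<^sub>e\<close>, and no information on a maximal cone of a lightcone
  subdivision is lost by restricting to it.

  More precisely, fix a nested set \<open>N\<close>.  A convex set on which the lightcone function is linear
  lies in the chamber of some strict ranking of \<open>N\<close>, where the minimum over each member of the
  Boolean building set is attained at its top-ranked element (\<open>linear_subset_chamber\<close>).  The
  point \<open>\<Delta>\<^sub>0 x\<close> for which \<open>x\<close> has the ranks as coordinates lies in this chamber, and in no other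
  (\<open>chamber_eq_of_ranking_point\<close>).  So the chambers are exactly the linearity domains, and
  each of them owns a diagonal point.  Subdivisions for different nested sets are
  compatible because the members of the Boolean building sets are connected in the tree
  (\<open>linear_on_larger_cone\<close>); hence the maximal cones of the fan are the chambers of the
  maximal nested sets.

  Since \<open>p\<close> is injective on the support of the nested set fan (\<open>atom_map_inject\<close>), the
  image of the diagonal point of a maximal cone lies in the image of no other maximal cone.  This
  gives the bijection (\<open>bij_betw_maximal_cones\<close>).

  On the cone of a maximal nested set the universe is cut out by \<open>m\<^bsub>top\<^esub> = 0\<close> and by the
  condition that \<open>\<lambda>\<close> is smallest at \<open>top\<close> (\<open>causal_form_lambda\<close>).  The maximal cones of a
  lightcone refinement of the universe fan are therefore the facets \<open>m\<^bsub>top\<^esub> = 0\<close> of the chambers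
  whose rankings put \<open>top\<close> first.  The diagonal point lies in the relative interior of this facet
  (\<open>ranking_point_relative_interior\<close>), and the same argument applies.
\<close>

section \<open>Nested sets\<close>

lemma maximal_above:
  fixes x :: "'b::{finite,order}"
  assumes "x \<in> S"
  shows "\<exists>m\<in>maximal_elements S. x \<le> m"
proof -
  obtain m where "m \<in> S" "x \<le> m" "\<forall>y\<in>S. m \<le> y \<longrightarrow> m = y"
    using finite_has_maximal2[OF finite assms] by blast
  then show ?thesis unfolding maximal_elements_def by auto
qed

lemma Sup_maximal_elements:
  fixes S :: "'a::{finite,complete_lattice} set"
  shows "Sup (maximal_elements S) = Sup S"
proof (rule antisym)
  show "Sup (maximal_elements S) \<le> Sup S"
    by (rule Sup_subset_mono) (auto simp: maximal_elements_def)
  show "Sup S \<le> Sup (maximal_elements S)"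
    by (rule Sup_least) (meson Sup_upper2 maximal_above)
qed

lemma nested_subset: "nested G N \<Longrightarrow> N' \<subseteq> N \<Longrightarrow> nested G N'"
  unfolding nested_def by (meson order_trans)

lemma nested_imp_subset: "nested G N \<Longrightarrow> N \<subseteq> G"
  unfolding nested_def by auto

lemma nested_not_bot:
  assumes "building_set G" "nested G N" "f \<in> N" shows "f \<noteq> bot"
  using assms unfolding building_set_def nested_def by auto

lemma nested_antichain:
  fixes N :: "'a::{finite,complete_lattice} set"
  assumes "nested G N" "A \<subseteq> N" "A \<noteq> {}" "pairwise (\<lambda>f g. \<not> f \<le> g \<and> \<not> g \<le> f) A" "Sup A \<in> G"
  shows "\<exists>f. A = {f}"
proof (rule ccontr)
  assume *: "\<not> ?thesis"
  have "card A \<noteq> 0" using assms by simp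
  moreover have "card A \<noteq> 1" using * by (metis card_1_singletonE)
  ultimately have "2 \<le> card A" by linarith
  then show False using assms unfolding nested_def by blast
qed

lemma maximal_elements_antichain:
  "pairwise (\<lambda>f g. \<not> f \<le> g \<and> \<not> g \<le> f) (maximal_elements S)"
  unfolding pairwise_def maximal_elements_def by auto

lemma join_product_disjoint:
  assumes "join_product M h" "g \<in> M" "g' \<in> M" "g \<noteq> g'"
  shows "inf g g' = bot"
proof -
  define x where "x = (\<lambda>m\<in>M. if m = g then inf g g' else bot)"
  define y where "y = (\<lambda>m\<in>M. if m = g' then inf g g' else bot)"
  have "x \<in> (\<Pi>\<^sub>E g\<in>M. {bot..g})" "y \<in> (\<Pi>\<^sub>E g\<in>M. {bot..g})"
    unfolding x_def y_def by (auto simp: PiE_def)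
  moreover have "(SUP m\<in>M. x m) \<le> inf g g'" by (rule SUP_least) (auto simp: x_def)
  moreover have "inf g g' \<le> (SUP m\<in>M. y m)"
    using SUP_upper[OF assms(3), of y] assms(3) by (simp add: y_def)
  ultimately have "x g \<le> y g" using assms unfolding join_product_def by (meson order_trans)
  then show ?thesis using assms by (auto simp: x_def y_def bot_unique)
qed

text \<open>
This is why a nested set can be recovered from joins.  Sort the maximal elements of \<open>N\<close> by the
factor \<open>m\<close> of \<open>[bot, Sup N]\<close> they lie in.  Those in \<open>m\<close> have join \<open>m \<in> G\<close>, because the product
decomposition is faithful, and nestedness forbids an antichain of two or more elements to have
its join in \<open>G\<close>; so each factor contains exactly one of them, namely \<open>m\<close> itself.
\<close>

lemma maximal_elements_nested:
  fixes G :: "'a::{finite,complete_lattice} set"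
  assumes bs: "building_set G" and nest: "nested G N"
  shows "maximal_elements N = maximal_elements {g \<in> G. g \<le> Sup N}"
proof (cases "N = {}")
  case True
  have "bot \<notin> G" using bs by (simp add: building_set_def)
  then show ?thesis using True by (auto simp: maximal_elements_def bot_unique)
next
  case ne: False
  define S where "S = maximal_elements N"
  define h where "h = Sup N"
  define M where "M = maximal_elements {g \<in> G. g \<le> h}"
  have hS: "h = Sup S" by (simp add: h_def S_def Sup_maximal_elements)
  have SN: "S \<subseteq> N" by (auto simp: S_def maximal_elements_def)
  have Sne: "S \<noteq> {}" using ne maximal_above unfolding S_def by blast
  have anti: "pairwise (\<lambda>f g. \<not> f \<le> g \<and> \<not> g \<le> f) S"
    unfolding S_def by (rule maximal_elements_antichain)
  have NG: "N \<subseteq> G" using nest by (rule nested_imp_subset)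
  have "S = M"
  proof (cases "h \<in> G")
    case True
    then obtain f where "S = {f}" using nested_antichain[OF nest SN Sne anti] hS by auto
    then have "S = {h}" using hS by simp
    moreover have "M = {h}" using True by (auto simp: M_def maximal_elements_def)
    ultimately show ?thesis by simp
  next
    case False
    obtain s where s: "s \<in> S" using Sne by auto
    have nb: "f \<noteq> bot" if "f \<in> S" for f using that SN nested_not_bot[OF bs nest] by auto
    have "h \<noteq> bot" using s nb hS by (metis Sup_upper bot_unique)
    then have jp: "join_product M h" using bs False by (simp add: building_set_def M_def)
    have ex: "\<exists>m\<in>M. f \<le> m" if "f \<in> S" for f
    proof -
      have "f \<in> {g \<in> G. g \<le> h}" using that SN NG hS by (auto intro: Sup_upper)
      then show ?thesis unfolding M_def by (rule maximal_above)
    qed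
    \<comment> \<open>The factor \<open>m\<close> is the join of the elements of \<open>S\<close> below it: otherwise replacing each
        factor by this join would give a second preimage of \<open>h\<close>.\<close>
    define b where "b m = Sup {f \<in> S. f \<le> m}" for m
    have bm: "b m = m" if "m \<in> M" for m
    proof -
      define x where "x = restrict id M"
      define y where "y = restrict b M"
      have "b m \<le> m" for m unfolding b_def by (rule Sup_least) auto
      then have y: "y \<in> (\<Pi>\<^sub>E g\<in>M. {bot..g})" by (auto simp: y_def)
      have x: "x \<in> (\<Pi>\<^sub>E g\<in>M. {bot..g})" by (auto simp: x_def)
      have "(SUP g\<in>M. x g) \<le> h" by (rule SUP_least) (auto simp: x_def M_def maximal_elements_def)
      also have "h \<le> (SUP g\<in>M. y g)"
        unfolding hS
      proof (rule Sup_least)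
        fix f assume f: "f \<in> S"
        then obtain m where m: "m \<in> M" "f \<le> m" using ex by auto
        have "f \<le> b m" unfolding b_def using f m by (auto intro: Sup_upper)
        also have "b m = y m" using m by (simp add: y_def)
        also have "y m \<le> (SUP g\<in>M. y g)" using m by (rule_tac SUP_upper)
        finally show "f \<le> (SUP g\<in>M. y g)" .
      qed
      finally have "\<forall>g\<in>M. x g \<le> y g" using jp x y unfolding join_product_def by blast
      then have "m \<le> b m" using that by (simp add: x_def y_def)
      then show ?thesis using \<open>\<And>m. b m \<le> m\<close> by (simp add: antisym)
    qed
    have single: "{f \<in> S. f \<le> m} = {m}" if m: "m \<in> M" for m
    proof -
      have mG: "m \<in> G" using m by (auto simp: M_def maximal_elements_def)
      have mb: "b m \<in> G" using bm[OF m] mG by simp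
      have "{f \<in> S. f \<le> m} \<noteq> {}"
      proof
        assume "{f \<in> S. f \<le> m} = {}"
        then have "b m = bot" unfolding b_def by (simp only: Sup_empty)
        then have "m = bot" using bm[OF m] by simp
        then show False using mG bs by (simp add: building_set_def)
      qed
      moreover have "pairwise (\<lambda>f g. \<not> f \<le> g \<and> \<not> g \<le> f) {f \<in> S. f \<le> m}"
        using anti by (rule pairwise_subset) auto
      ultimately obtain f where f: "{f \<in> S. f \<le> m} = {f}"
        using nested_antichain[OF nest, of "{f \<in> S. f \<le> m}"] mb SN unfolding b_def by auto
      then show ?thesis using bm[OF m] by (simp add: b_def)
    qed
    show ?thesis
    proof
      show "M \<subseteq> S" using single by blast
      show "S \<subseteq> M"
      proof
        fix f assume "f \<in> S"
        then obtain m where "m \<in> M" "f \<le> m" using ex by auto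
        with single[of m] \<open>f \<in> S\<close> show "f \<in> M" by auto
      qed
    qed
  qed
  then show ?thesis by (simp add: S_def M_def h_def)
qed

text \<open>
Two incomparable elements of a nested set are the factors of the interval below their join.
\<close>

lemma nested_incomparable:
  fixes G :: "'a::{finite,complete_lattice} set"
  assumes bs: "building_set G" and nest: "nested G N"
    and fg: "f \<in> N" "g \<in> N" "\<not> f \<le> g" "\<not> g \<le> f"
  shows "inf f g = bot"
proof -
  have n2: "nested G {f, g}" using nested_subset[OF nest] fg by auto
  have "maximal_elements {f, g} = {f, g}" using fg by (auto simp: maximal_elements_def)
  then have eq: "{f, g} = maximal_elements {k \<in> G. k \<le> Sup {f, g}}"
    using maximal_elements_nested[OF bs n2] by simp
  have ne: "f \<noteq> g" using fg by auto
  then have "card {f, g} = 2" by simp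
  moreover have "pairwise (\<lambda>f g. \<not> f \<le> g \<and> \<not> g \<le> f) {f, g}" using fg by (auto simp: pairwise_def)
  ultimately have "Sup {f, g} \<notin> G"
    using n2[unfolded nested_def, THEN conjunct2, rule_format, of "{f, g}"] by simp
  moreover have "Sup {f, g} \<noteq> bot"
    using nested_not_bot[OF bs nest fg(1)] by (metis Sup_upper bot_unique insertI1)
  ultimately have "join_product {f, g} (Sup {f, g})"
    using bs unfolding building_set_def by (subst eq) blast
  then show ?thesis by (rule join_product_disjoint) (use ne in auto)
qed

lemma nested_not_above_iff:
  assumes "building_set G" "nested G N" "e \<in> N" "f \<in> N"
  shows "f < e \<or> inf f e = bot \<longleftrightarrow> \<not> e \<le> f"
proof (cases "e \<le> f")
  case True
  then have "inf f e = e" by (simp add: inf_absorb2)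
  then show ?thesis using True nested_not_bot[OF assms(1-3)] by auto
next
  case False
  then show ?thesis using nested_incomparable[OF assms(1,2,4,3)] by (auto simp: le_less)
qed

lemma nested_maximal_superset:
  assumes "nested G N"
  obtains N' where "nested G N'" "N \<subseteq> N'" "\<And>M. nested G M \<Longrightarrow> N' \<subseteq> M \<Longrightarrow> M = N'"
proof -
  have "N \<in> {N. nested G N}" using assms by simp
  from maximal_above[OF this] obtain N' where "N' \<in> maximal_elements {N. nested G N}" "N \<subseteq> N'"
    by blast
  then show ?thesis by (intro that[of N']) (auto simp: maximal_elements_def)
qed

lemma nested_insert_top:
  assumes "building_set G" "nested G N"
  shows "nested G (insert top N)"
  unfolding nested_def
proof (intro conjI allI impI)
  show "insert top N \<subseteq> G" using assms by (auto simp: nested_def building_set_def)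
  fix A assume A: "A \<subseteq> insert top N" 
    and 2: "2 \<le> card A \<and> pairwise (\<lambda>f g. \<not> f \<le> g \<and> \<not> g \<le> f) A"
  have "top \<notin> A"
  proof
    assume t: "top \<in> A"
    have "x = top" if "x \<in> A" for x
      using 2 t that top_greatest[of x] unfolding pairwise_def by blast
    then have "A \<subseteq> {top}" by auto
    then have "card A \<le> 1" using card_mono[of "{top::'a}" A] by simp
    then show False using 2 by simp
  qed
  then show "Sup A \<notin> G" using A 2 assms(2) unfolding nested_def by blast
qed

section \<open>Injectivity on the nested set fan\<close>

text \<open>
The map \<open>p\<close> to \<open>\<real>\<^sup>E\<close>, read as a function on atoms.  Below it is inverted on the nonnegative
vectors with nested support.
\<close>

definition atom_sum :: "'a::{finite,complete_lattice} coords \<Rightarrow> 'a \<Rightarrow> real" where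
  "atom_sum x e = (\<Sum>f | e \<le> f. x $ f)"

lemma atom_map_nth:
  assumes "x \<in> coord_space G" "e \<in> atoms"
  shows "atom_map G x $ e = atom_sum x e"
proof -
  have "atom_map G x $ e = (\<Sum>f\<in>G. x $ f * (\<Sum>d\<in>atoms_below f. axis d 1 $ e))"
    by (simp add: atom_map_def)
  also have "\<dots> = (\<Sum>f\<in>G. if e \<le> f then x $ f else 0)"
    using assms(2) by (intro sum.cong refl) (simp add: axis_def atoms_below_def if_distrib cong: if_cong)
  also have "\<dots> = (\<Sum>f\<in>UNIV. if e \<le> f then x $ f else 0)"
    using assms(1) by (intro sum.mono_neutral_left) (auto simp: coord_space_def)
  also have "\<dots> = atom_sum x e" by (simp add: atom_sum_def sum.If_cases)
  finally show ?thesis .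
qed

definition supp :: "'a::{finite,complete_lattice} coords \<Rightarrow> 'a set" where
  "supp x = {f. x $ f \<noteq> 0}"

lemma atom_sum_mono:
  assumes "\<And>f. 0 \<le> x $ f" "e \<le> f" shows "x $ f \<le> atom_sum x e"
  unfolding atom_sum_def using assms by (intro member_le_sum) auto

text \<open>
If the atoms below \<open>f\<close> were all covered by support elements strictly below \<open>f\<close>, the join of the
maximal ones among these would be \<open>f\<close>, against nestedness.  An atom that is not covered sees
only the coordinate at \<open>f\<close>.
\<close>

lemma atom_sum_eq_coordinate:
  assumes at: "atomic_lattice TYPE('a)" and nest: "nested G (supp x)"
    and f: "f \<in> maximal_elements (supp x)" and bs: "building_set G"
  shows "\<exists>e\<in>atoms_below (f::'a::{finite,complete_lattice}). atom_sum x e = x $ f"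
proof -
  define T where "T = maximal_elements {g \<in> supp x. g < f}"
  have fG: "f \<in> supp x" "f \<in> G" using f nested_imp_subset[OF nest] by (auto simp: maximal_elements_def)
  have "\<exists>e\<in>atoms_below f. \<forall>g\<in>supp x. g < f \<longrightarrow> \<not> e \<le> g"
  proof (rule ccontr)
    assume "\<not> ?thesis"
    then have *: "\<exists>g. g \<in> supp x \<and> g < f \<and> e \<le> g" if "e \<in> atoms_below f" for e using that by blast
    have "f \<le> Sup T"
    proof -
      have "Sup (atoms_below f) \<le> Sup T"
      proof (rule Sup_least)
        fix e assume "e \<in> atoms_below f"
        then obtain g where g: "g \<in> {g \<in> supp x. g < f}" "e \<le> g" using * by blast
        obtain t where "t \<in> T" "g \<le> t" using maximal_above[OF g(1)] unfolding T_def by auto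
        then show "e \<le> Sup T" using g(2) by (meson Sup_upper order_trans)
      qed
      then show ?thesis using at by (simp add: atomic_lattice_def)
    qed
    moreover have "Sup T \<le> f" by (rule Sup_least) (auto simp: T_def maximal_elements_def)
    ultimately have eq: "Sup T = f" by simp
    have "T \<noteq> {}" using eq nested_not_bot[OF bs nest fG(1)] by auto
    moreover have "T \<subseteq> supp x" by (auto simp: T_def maximal_elements_def)
    moreover have "pairwise (\<lambda>f g. \<not> f \<le> g \<and> \<not> g \<le> f) T"
      unfolding T_def by (rule maximal_elements_antichain)
    ultimately obtain g where g: "T = {g}" using nested_antichain[OF nest, of T] eq fG by auto
    then have "g = f" using eq by simp
    then show False using g by (auto simp: T_def maximal_elements_def)
  qed
  then obtain e where e: "e \<in> atoms_below f" and no: "\<forall>g\<in>supp x. g < f \<longrightarrow> \<not> e \<le> g" by blast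
  have eb: "e \<noteq> bot" "e \<le> f" using e by (auto simp: atoms_below_def atoms_def)
  have "g = f" if "g \<in> supp x" "e \<le> g" for g
  proof -
    have "e \<le> inf f g" using eb that by simp
    then have "inf f g \<noteq> bot" using eb(1) by (metis bot_unique)
    then have "f \<le> g \<or> g \<le> f" using nested_incomparable[OF bs nest fG(1) that(1)] by auto
    then show ?thesis using f no that by (auto simp: maximal_elements_def le_less)
  qed
  then have "atom_sum x e = (\<Sum>g\<in>{f}. x $ g)"
    unfolding atom_sum_def using eb by (intro sum.mono_neutral_right) (auto simp: supp_def)
  then show ?thesis using e by auto
qed

text \<open>
The join of the support, hence by \<open>maximal_elements_nested\<close> also the set of its
maximal elements, can be read off from the atom sums.
\<close>

lemma Sup_support:
  fixes x :: "'a::{finite,complete_lattice} coords"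
  assumes at: "atomic_lattice TYPE('a)" and pos: "\<And>f. 0 \<le> x $ f"
  shows "Sup (supp x) = Sup {e \<in> atoms. atom_sum x e > 0}"
proof (rule antisym)
  show "Sup (supp x) \<le> Sup {e \<in> atoms. atom_sum x e > 0}"
  proof (rule Sup_least)
    fix f assume "f \<in> supp x"
    then have "0 < x $ f" using pos[of f] by (simp add: supp_def)
    then have "atoms_below f \<subseteq> {e \<in> atoms. atom_sum x e > 0}"
      using atom_sum_mono[OF pos] unfolding atoms_below_def by (force intro: less_le_trans)
    then have "Sup (atoms_below f) \<le> Sup {e \<in> atoms. atom_sum x e > 0}" by (rule Sup_subset_mono)
    then show "f \<le> Sup {e \<in> atoms. atom_sum x e > 0}" using at by (simp add: atomic_lattice_def)
  qed
  show "Sup {e \<in> atoms. atom_sum x e > 0} \<le> Sup (supp x)"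
  proof (rule Sup_least)
    fix e assume "e \<in> {e \<in> atoms. atom_sum x e > 0}"
    then have "atom_sum x e \<noteq> 0" by simp
    then obtain f where "e \<le> f" "x $ f \<noteq> 0"
      unfolding atom_sum_def by (auto elim: sum.not_neutral_contains_not_neutral)
    then show "e \<le> Sup (supp x)" by (auto simp: supp_def intro: Sup_upper2)
  qed
qed

text \<open>
Vectors with equal atom sums have the same maximal support elements \<open>f\<close>, and their coordinates
at \<open>f\<close> agree, both being the minimum of the atom sums over the atoms below \<open>f\<close>.  Subtracting
this coordinate shrinks the support, and induction applies.
\<close>

lemma atom_sum_inject:
  fixes x y :: "'a::{finite,complete_lattice} coords"
  assumes at: "atomic_lattice TYPE('a)" and bs: "building_set G"
    and "\<And>f. 0 \<le> x $ f" "\<And>f. 0 \<le> y $ f" "nested G (supp x)" "nested G (supp y)"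
    and "\<And>e. e \<in> atoms \<Longrightarrow> atom_sum x e = atom_sum y e"
  shows "x = y"
  using assms(3-)
proof (induction "card (supp x)" arbitrary: x y)
  case 0
  have supp_eq: "Sup (supp x) = Sup (supp y)"
    using Sup_support[OF at 0(2)] Sup_support[OF at 0(3)] 0(6) by (simp cong: conj_cong)
  have "supp x = {}" using 0 by simp
  moreover from this have "Sup (supp y) = bot" using supp_eq by simp
  then have "supp y = {}" using nested_not_bot[OF bs 0(5)] by auto
  ultimately show ?case by (simp add: supp_def vec_eq_iff)
next
  case (Suc n)
  note pos = Suc(3,4) and nest = Suc(5,6)
  have "{e \<in> atoms. atom_sum x e > 0} = {e \<in> atoms. atom_sum y e > 0}" using Suc(7) by auto
  then have "Sup (supp x) = Sup (supp y)"
    using Sup_support[OF at pos(1)] Sup_support[OF at pos(2)] by simp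
  then have max: "maximal_elements (supp x) = maximal_elements (supp y)"
    using maximal_elements_nested[OF bs] nest by simp
  obtain g where "g \<in> supp x" using Suc(2) by fastforce
  then obtain f where fx: "f \<in> maximal_elements (supp x)" using maximal_above by blast
  then have fy: "f \<in> maximal_elements (supp y)" using max by simp
  have le: "a $ f \<le> b $ f" if h: "f \<in> maximal_elements (supp b)" "nested G (supp b)" "\<And>f. 0 \<le> a $ f"
    "\<And>e. e \<in> atoms \<Longrightarrow> atom_sum a e = atom_sum b e" for a b :: "'a coords"
  proof -
    obtain e where e: "e \<in> atoms_below f" "atom_sum b e = b $ f"
      using atom_sum_eq_coordinate[OF at h(2,1) bs] by auto
    then show ?thesis using atom_sum_mono[of a e f] h(3,4) by (auto simp: atoms_below_def)
  qed
  have eq: "x $ f = y $ f"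
    using le[OF fx nest(1) pos(2)] le[OF fy nest(2) pos(1)] Suc(7) by (simp add: antisym)
  define d where "d = axis f (x $ f)"
  have nth: "(x - d) $ g = (if g = f then 0 else x $ g)" "(y - d) $ g = (if g = f then 0 else y $ g)" for g
    by (auto simp: d_def axis_def eq)
  have supp: "supp (x - d) = supp x - {f}" "supp (y - d) = supp y - {f}"
    using nth by (auto simp: supp_def split: if_splits)
  have "f \<in> supp x" using fx by (simp add: maximal_elements_def)
  then have "n = card (supp (x - d))" using Suc(2) by (simp add: supp)
  moreover have "0 \<le> (x - d) $ g" "0 \<le> (y - d) $ g" for g using pos unfolding nth by auto
  moreover have "nested G (supp (x - d))" "nested G (supp (y - d))"
    unfolding supp using nest by (auto intro: nested_subset)
  moreover have "atom_sum (x - d) e = atom_sum (y - d) e" if "e \<in> atoms" for e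
    using Suc(7)[OF that] by (simp add: atom_sum_def sum_subtractf)
  ultimately have "x - d = y - d" by (rule Suc(1))
  then show ?case by simp
qed

section \<open>Coordinates and forms on the cones\<close>

lemma linear_pco: "linear (pco f)"
  by (intro linearI) (simp_all add: pco_def)

lemma linear_mco: "linear (mco f)"
  by (intro linearI) (simp_all add: mco_def)

lemma linear_lambda_form: "linear (lambda_form N e)"
  unfolding lambda_form_def[abs_def]
  by (intro linear_compose_add linear_compose_sum ballI linear_pco linear_mco)

lemmas pco_simps = linear_add[OF linear_pco] linear_scale[OF linear_pco] linear_diff[OF linear_pco]
lemmas mco_simps = linear_add[OF linear_mco] linear_scale[OF linear_mco] linear_diff[OF linear_mco]

lemma pco_gens [simp]:
  "pco f (plus_vec g) = (if g = f then 1 else 0)" "pco f (minus_vec g) = 0"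
  "mco f (minus_vec g) = (if g = f then 1 else 0)" "mco f (plus_vec g) = 0"
  by (auto simp: pco_def mco_def plus_vec_def minus_vec_def axis_def)

lemma doubled_eqI:
  assumes "\<And>f. pco f v = pco f w" "\<And>f. mco f v = mco f w" shows "v = w"
  using assms by (simp add: pco_def mco_def prod_eq_iff vec_eq_iff)

lemma nested_cone_iff:
  "v \<in> nested_cone N \<longleftrightarrow>
     (\<forall>f. 0 \<le> pco f v \<and> 0 \<le> mco f v \<and> (f \<notin> N \<longrightarrow> pco f v = 0 \<and> mco f v = 0))"
  (is "_ \<longleftrightarrow> ?P v")
proof
  have "nested_cone N \<subseteq> {v. ?P v}"
    unfolding nested_cone_def
  proof (rule hull_minimal)
    show "convex_cone {v. ?P v}"
      by (auto simp: convex_cone_iff pco_simps mco_simps linear_0[OF linear_pco] linear_0[OF linear_mco])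
  qed auto
  then show "v \<in> nested_cone N \<Longrightarrow> ?P v" by auto
next
  assume P: "?P v"
  let ?H = "convex_cone hull (plus_vec ` N \<union> minus_vec ` N)"
  let ?w = "(\<Sum>f\<in>N. pco f v *\<^sub>R plus_vec f + mco f v *\<^sub>R minus_vec f)"
  have "v = ?w"
  proof (rule doubled_eqI)
    fix f
    have "pco f ?w = (\<Sum>g\<in>N. if g = f then pco f v else 0)"
      unfolding linear_sum[OF linear_pco] by (intro sum.cong refl) (simp add: pco_simps)
    then show "pco f v = pco f ?w" using P by simp
    have "mco f ?w = (\<Sum>g\<in>N. if g = f then mco f v else 0)"
      unfolding linear_sum[OF linear_mco] by (intro sum.cong refl) (simp add: mco_simps)
    then show "mco f v = mco f ?w" using P by simp
  qed
  moreover have "?w \<in> ?H"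
  proof -
    have sum: "sum u A \<in> ?H" if "\<And>f. f \<in> A \<Longrightarrow> u f \<in> ?H" for u and A :: "'a set"
      using finite[of A] that
      by (induction A rule: finite_induct) (auto intro: convex_cone_hull_add convex_cone_hull_contains_0)
    show ?thesis
      using P by (intro sum convex_cone_hull_add convex_cone_hull_mul) (auto intro: hull_inc)
  qed
  ultimately show "v \<in> nested_cone N" by (simp add: nested_cone_def)
qed

lemma nested_cone_mono: "N' \<subseteq> N \<Longrightarrow> nested_cone N' \<subseteq> nested_cone N"
  unfolding nested_cone_iff subset_iff by blast

lemma convex_nested_cone: "convex (nested_cone N)"
  unfolding nested_cone_def by (rule convex_convex_cone_hull)

lemma pco_Delta0: "pco f (Delta0 G x) = (if f \<in> G then x $ f else 0)"
proof -
  have "pco f (Delta0 G x) = (\<Sum>g\<in>G. if g = f then x $ f else 0)"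
    unfolding Delta0_def linear_sum[OF linear_pco] by (intro sum.cong refl) (auto simp: pco_simps)
  then show ?thesis by simp
qed

lemma mco_Delta0: "mco f (Delta0 G x) = (if f \<in> G \<and> f \<noteq> top then x $ f else 0)"
proof -
  have "mco f (Delta0 G x) = (\<Sum>g\<in>G. if g = f then if f = top then 0 else x $ f else 0)"
    unfolding Delta0_def linear_sum[OF linear_mco] by (intro sum.cong refl) (auto simp: mco_simps)
  then show ?thesis by simp
qed

lemma lambda_form_nested:
  assumes "building_set G" "nested G N" "e \<in> N"
  shows "lambda_form N e v = (\<Sum>f | f \<in> N \<and> e < f. pco f v) + (\<Sum>f | f \<in> N \<and> \<not> e \<le> f. mco f v)"
proof -
  have "{f \<in> N. f < e \<or> inf f e = bot} = {f \<in> N. \<not> e \<le> f}"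
    using nested_not_above_iff[OF assms] by blast
  then show ?thesis unfolding lambda_form_def by simp
qed

lemma lambda_form_subset:
  assumes "N' \<subseteq> N" "v \<in> nested_cone N'"
  shows "lambda_form N e v = lambda_form N' e v"
  unfolding lambda_form_def using assms
  by (intro arg_cong2[of _ _ _ _ "(+)"] sum.mono_neutral_right) (auto simp: nested_cone_iff)

text \<open>
A potential on the vertices of the rooted tree of \<open>N\<close>: the form \<open>\<lambda>\<^sub>e\<close> is its value at the lower
end of the edge \<open>e\<close> minus \<open>p\<^sub>e\<close>, and also its value at the upper end minus \<open>m\<^sub>e\<close>.  The potential is
thus constant along an edge \<open>e\<close> on which \<open>p\<^sub>e\<close> and \<open>m\<^sub>e\<close> vanish.
\<close>

definition potential :: "'a::{finite,complete_lattice} set \<Rightarrow> 'a doubled \<Rightarrow> 'a option \<Rightarrow> real" where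
  "potential N v u = (case u of
      None \<Rightarrow> (\<Sum>f\<in>N. mco f v)
    | Some f \<Rightarrow> (\<Sum>g | g \<in> N \<and> f \<le> g. pco g v) + (\<Sum>g | g \<in> N \<and> \<not> f \<le> g. mco g v))"

lemma lambda_form_potential:
  assumes bs: "building_set G" and nest: "nested G N" and e: "e \<in> N" and u: "u \<in> tree_edge N e"
  shows "lambda_form N e v = potential N v u - (if u = Some e then pco e v else mco e v)"
proof -
  note lam = lambda_form_nested[OF bs nest e, of v]
  consider "u = Some e"
    | f where "u = Some f" "f \<in> N" "e < f" "\<not> (\<exists>g\<in>N. e < g \<and> g < f)"
    | "u = None" "e \<in> maximal_elements N"
    using u by (auto simp: tree_edge_def tree_covers_def split: if_splits)
  then show ?thesis
  proof cases
    case 1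
    have "{g. g \<in> N \<and> e \<le> g} = insert e {g. g \<in> N \<and> e < g}" using e by auto
    then show ?thesis using 1 by (simp add: lam potential_def)
  next
    case (2 f)
    have above: "f \<le> g" if "g \<in> N" "e < g" for g
    proof -
      have "e \<le> inf f g" using 2 that by (simp add: less_imp_le)
      then have "inf f g \<noteq> bot" using nested_not_bot[OF bs nest e] by (metis bot_unique)
      then show ?thesis using nested_incomparable[OF bs nest \<open>f \<in> N\<close> that(1)] 2(4) that
        by (auto simp: le_less)
    qed
    have 1: "{g. g \<in> N \<and> e < g} = {g. g \<in> N \<and> f \<le> g}" using above 2 by (auto intro: less_le_trans)
    have 3: "{g. g \<in> N \<and> \<not> f \<le> g} = insert e {g. g \<in> N \<and> \<not> e \<le> g}"
      using above 2 e by (auto simp: le_less intro: less_trans)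
    show ?thesis using 2 by (auto simp: lam potential_def 1 3)
  next
    case 3
    have 1: "{g. g \<in> N \<and> e < g} = {}" using 3 by (auto simp: maximal_elements_def)
    have 2: "N = insert e {g. g \<in> N \<and> \<not> e \<le> g}" using 3 e by (auto simp: maximal_elements_def)
    have "(\<Sum>g\<in>N. mco g v) = mco e v + (\<Sum>g | g \<in> N \<and> \<not> e \<le> g. mco g v)"
      by (subst 2) simp
    then show ?thesis using 3 unfolding lam 1 by (simp add: potential_def)
  qed
qed

text \<open>
Walk through the connected set \<open>t\<close> from \<open>e\<close> to \<open>f\<close>.  The potential equals \<open>\<lambda>\<^sub>e\<close> until the walk
meets an edge \<open>d\<close> of \<open>N'\<close>, and for this one \<open>\<lambda>\<^sub>d\<close> is at most the potential at its ends.
\<close>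

lemma potential_along_tree:
  assumes bs: "building_set G" and nest: "nested G N" and t: "connected_edge_set N t" "t \<subseteq> N"
    and v: "v \<in> nested_cone N'" and e: "e \<in> t" "e \<notin> N'" and f: "f \<in> t"
  shows "potential N v (Some f) = lambda_form N e v \<or>
    (\<exists>d\<in>t \<inter> N'. lambda_form N d v \<le> lambda_form N e v)"
proof -
  have zero: "pco d v = 0" "mco d v = 0" if "d \<notin> N'" for d using v that by (auto simp: nested_cone_iff)
  have nonneg: "0 \<le> pco d v" "0 \<le> mco d v" for d using v by (auto simp: nested_cone_iff)
  have "Some e \<in> \<Union> (tree_edge N ` t)" "Some f \<in> \<Union> (tree_edge N ` t)"
    using e f by (auto simp: tree_edge_def)
  then have "(Some e, Some f) \<in> {(a, b). \<exists>e\<in>t. a \<in> tree_edge N e \<and> b \<in> tree_edge N e}\<^sup>*"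
    using t(1) unfolding connected_edge_set_def by blast
  then show ?thesis
  proof (induction rule: rtrancl_induct)
    case base
    have "Some e \<in> tree_edge N e" by (simp add: tree_edge_def)
    then have "lambda_form N e v = potential N v (Some e) - pco e v"
      using lambda_form_potential[OF bs nest, of e "Some e" v] e(1) t(2) by auto
    then show ?case using zero[OF e(2)] by simp
  next
    case (step a b)
    from step(2) obtain d where d: "d \<in> t" "a \<in> tree_edge N d" "b \<in> tree_edge N d" by auto
    have "d \<in> N" using d t by auto
    note pot = lambda_form_potential[OF bs nest this d(2), of v] lambda_form_potential[OF bs nest this d(3), of v]
    show ?case
    proof (cases "d \<in> N'")
      case True
      have "lambda_form N d v \<le> potential N v a" using pot(1) nonneg[of d] by (auto split: if_splits)
      then show ?thesis using step(3) True d(1) by auto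
    next
      case False
      then have "potential N v a = potential N v b" using pot zero[OF False] by (auto split: if_splits)
      then show ?thesis using step(3) by simp
    qed
  qed
qed

lemma lambda_form_Some:
  assumes "building_set G" "nested G N" "e \<in> N"
  shows "lambda_form N e v = potential N v (Some e) - pco e v"
  using lambda_form_potential[OF assms, of "Some e" v] by (simp add: tree_edge_def)

text \<open>
This and the next lemma are where connectedness of the members of the Boolean building sets is
used: on the cone of \<open>N' \<subseteq> N\<close> a minimum over \<open>t\<close> is the minimum over \<open>t \<inter> N'\<close>, or linear if \<open>t\<close>
misses \<open>N'\<close>, so the subdivisions for \<open>N'\<close> and \<open>N\<close> fit together.
\<close>

lemma lambda_form_min_on_face:
  assumes bs: "building_set G" and nest: "nested G N" and t: "connected_edge_set N t" "t \<subseteq> N"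
    and v: "v \<in> nested_cone N'" and e: "e \<in> t" and ne: "t \<inter> N' \<noteq> {}"
  shows "\<exists>d\<in>t \<inter> N'. lambda_form N d v \<le> lambda_form N e v"
proof (cases "e \<in> N'")
  case False
  obtain f where f: "f \<in> t" "f \<in> N'" using ne by auto
  have "lambda_form N f v \<le> potential N v (Some f)"
    using lambda_form_Some[OF bs nest, of f v] f t v by (auto simp: nested_cone_iff)
  then show ?thesis using potential_along_tree[OF bs nest t v e False f(1)] f by auto
qed (use e in auto)

lemma lambda_form_constant_off_face:
  assumes bs: "building_set G" and nest: "nested G N" and t: "connected_edge_set N t" "t \<subseteq> N"
    and v: "v \<in> nested_cone N'" and e: "e \<in> t" "d \<in> t" and disj: "t \<inter> N' = {}"
  shows "lambda_form N d v = lambda_form N e v"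
proof -
  have "pco d v = 0" "e \<notin> N'" using v e disj by (auto simp: nested_cone_iff)
  then show ?thesis
    using potential_along_tree[OF bs nest t v e(1) _ e(2)] lambda_form_Some[OF bs nest, of d v] disj e t by auto
qed

section \<open>Chambers\<close>

text \<open>
The ranking \<open>r\<close> prescribes where the minimum of the \<open>\<lambda>\<^sub>e\<close> over each \<open>t\<close> is attained, namely at
the element of \<open>t\<close> of highest rank.
\<close>

definition chamber :: "'a::{finite,complete_lattice} set \<Rightarrow> 'a set set \<Rightarrow> ('a \<Rightarrow> real) \<Rightarrow> 'a doubled set" where
  "chamber N \<B> r = {v \<in> nested_cone N. \<forall>t\<in>\<B>. \<forall>c\<in>t. \<forall>e\<in>t.
     (\<forall>d\<in>t. r d \<le> r c) \<longrightarrow> lambda_form N c v \<le> lambda_form N e v}"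

text \<open>
A strict refinement of the order that ranks small values of \<open>h\<close> high; among elements of
equal value, \<open>e0\<close> is ranked highest.
\<close>

lemma ranking_exists:
  fixes h :: "'b::finite \<Rightarrow> real"
  shows "\<exists>r::'b \<Rightarrow> real. inj r \<and> (\<forall>e. 0 < r e) \<and> (\<forall>e e'. h e < h e' \<longrightarrow> r e' < r e) \<and>
     (\<forall>e. h e0 \<le> h e \<longrightarrow> r e \<le> r e0)"
proof -
  obtain i :: "'b \<Rightarrow> nat" where i: "inj i"
    using finite_imp_inj_to_nat_seg[OF finite[of "UNIV::'b set"]] by auto
  define j where "j e = (if e = e0 then 0 else Suc (i e))" for e
  have j: "j e = j e' \<longleftrightarrow> e = e'" for e e' using i by (auto simp: j_def inj_eq)
  define lt where "lt e e' \<longleftrightarrow> h e < h e' \<or> h e = h e' \<and> j e < j e'" for e e'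
  define r where "r e = card {e'. \<not> lt e' e}" for e
  have less: "r e' < r e" if "lt e e'" for e e'
    unfolding r_def
  proof (rule psubset_card_mono[OF finite], rule psubsetI)
    show "{d. \<not> lt d e'} \<subseteq> {d. \<not> lt d e}" using that by (auto simp: lt_def)
    have "e \<in> {d. \<not> lt d e}" "e \<notin> {d. \<not> lt d e'}" using that by (auto simp: lt_def)
    then show "{d. \<not> lt d e'} \<noteq> {d. \<not> lt d e}" by blast
  qed
  have tri: "lt e e' \<or> lt e' e \<or> e = e'" for e e' using j[of e e'] by (auto simp: lt_def)
  have "inj r" using less tri by (metis injI less_irrefl)
  moreover have "0 < r e" for e
  proof -
    have "e \<in> {d. \<not> lt d e}" by (simp add: lt_def)
    then show ?thesis unfolding r_def by (auto simp: card_gt_0_iff)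
  qed
  moreover have "r e' < r e" if "h e < h e'" for e e' using less that by (simp add: lt_def)
  moreover have "r e \<le> r e0" if "h e0 \<le> h e" for e
  proof -
    have "\<not> lt e e0" using that by (auto simp: lt_def j_def)
    then show ?thesis using tri[of e e0] less[of e0 e] by auto
  qed
  ultimately show ?thesis by (intro exI[of _ "\<lambda>e. real (r e)"]) (auto simp: inj_def)
qed

lemma exists_max_rank:
  fixes r :: "'a::finite \<Rightarrow> real"
  assumes "t \<noteq> {}" shows "\<exists>c\<in>t. \<forall>d\<in>t. r d \<le> r c"
proof -
  have "Max (r ` t) \<in> r ` t" using assms by (intro Max_in) auto
  then obtain c where "c \<in> t" "Max (r ` t) = r c" by auto
  then show ?thesis by (metis Max_ge finite finite_imageI imageI)
qed

lemma lightcone_function_eq: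
  assumes "\<And>t. t \<in> \<B> \<Longrightarrow> c t \<in> t \<and> (\<forall>e\<in>t. lambda_form N (c t) v \<le> lambda_form N e v)"
  shows "lightcone_function N \<B> v = (\<Sum>t\<in>\<B>. lambda_form N (c t) v)"
  unfolding lightcone_function_def using assms
  by (intro sum.cong refl Min_eqI) auto

lemma linear_sum_lambda_form: "linear (\<lambda>v. \<Sum>t\<in>\<B>. lambda_form N (c t) v)"
  by (intro linear_compose_sum ballI linear_lambda_form)

lemma convex_chamber: "convex (chamber N \<B> r)"
proof -
  let ?H = "\<lambda>c e. {v. lambda_form N c v \<le> lambda_form N e v}"
  have half: "convex (?H c e)" for c e
  proof (rule convexI)
    fix x y and a b :: real assume "x \<in> ?H c e" "y \<in> ?H c e" "0 \<le> a" "0 \<le> b"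
    then show "a *\<^sub>R x + b *\<^sub>R y \<in> ?H c e"
      by (auto simp: linear_add[OF linear_lambda_form] linear_scale[OF linear_lambda_form]
          intro!: add_mono mult_left_mono)
  qed
  have "chamber N \<B> r = nested_cone N \<inter>
      (\<Inter>t\<in>\<B>. \<Inter>c\<in>{c\<in>t. \<forall>d\<in>t. r d \<le> r c}. \<Inter>e\<in>t. ?H c e)"
    by (auto simp: chamber_def)
  then show ?thesis by (auto intro!: convex_Int convex_nested_cone convex_INT half)
qed

lemma chamber_linear:
  assumes "\<And>t. t \<in> \<B> \<Longrightarrow> t \<noteq> {}"
  shows "\<exists>l. linear l \<and> (\<forall>v\<in>chamber N \<B> r. lightcone_function N \<B> v = l v)"
proof -
  have "\<forall>t\<in>\<B>. \<exists>c. c \<in> t \<and> (\<forall>d\<in>t. r d \<le> r c)"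
    using exists_max_rank[where r = r] assms by (metis (no_types))
  then obtain c where c: "\<And>t. t \<in> \<B> \<Longrightarrow> c t \<in> t \<and> (\<forall>d\<in>t. r d \<le> r (c t))" by metis
  have "lightcone_function N \<B> v = (\<Sum>t\<in>\<B>. lambda_form N (c t) v)" if "v \<in> chamber N \<B> r" for v
    by (rule lightcone_function_eq) (use c that in \<open>auto simp: chamber_def\<close>)
  then show ?thesis using linear_sum_lambda_form by blast
qed

text \<open>
Each summand of the lightcone function is concave.  Take \<open>v0\<close> in the relative interior of \<open>C\<close> and
rank \<open>N\<close> against the values \<open>\<lambda>\<^sub>e v0\<close>.  Replacing each minimum by the form of the top-ranked
element gives a linear upper bound of the lightcone function that is sharp at \<open>v0\<close>; on \<open>C\<close> the
difference is linear, nonnegative and zero at a relative interior point, hence zero, and so every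
single minimum is attained where the ranking says.

The element \<open>e0\<close> is a tie-breaker: if \<open>\<lambda>\<close> is smallest at \<open>e0\<close> throughout \<open>C\<close>, then \<open>e0\<close> may be
ranked highest.  For the universe fan this is applied to \<open>top\<close>.
\<close>

lemma linear_subset_chamber:
  fixes N :: "'a::{finite,complete_lattice} set"
  assumes C: "convex C" "C \<noteq> {}" "C \<subseteq> nested_cone N"
    and ne: "\<And>t. t \<in> \<B> \<Longrightarrow> t \<noteq> {}"
    and l: "linear l" "\<And>v. v \<in> C \<Longrightarrow> lightcone_function N \<B> v = l v"
  obtains r where "inj r" "\<And>e. 0 < r e" "C \<subseteq> chamber N \<B> r"
    "(\<And>v e. v \<in> C \<Longrightarrow> e \<in> N \<Longrightarrow> lambda_form N e0 v \<le> lambda_form N e v) \<Longrightarrow> \<forall>e\<in>N. r e \<le> r e0"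
proof -
  obtain v0 where v0: "v0 \<in> rel_interior C" using C rel_interior_eq_empty by blast
  have v0C: "v0 \<in> C" using v0 rel_interior_subset by blast
  obtain r :: "'a \<Rightarrow> real" where r: "inj r" "\<And>e. 0 < r e"
      "\<And>e e'. lambda_form N e v0 < lambda_form N e' v0 \<Longrightarrow> r e' < r e"
      "\<And>e. lambda_form N e0 v0 \<le> lambda_form N e v0 \<Longrightarrow> r e \<le> r e0"
    using ranking_exists[of "\<lambda>e. lambda_form N e v0" e0] by auto
  have sub: "lambda_form N c v \<le> lambda_form N e v"
    if t0: "t0 \<in> \<B>" "c \<in> t0" "e \<in> t0" "\<forall>d\<in>t0. r d \<le> r c" and v: "v \<in> C" for t0 c e v
  proof -
    have "\<forall>t\<in>\<B>. \<exists>c'. c' \<in> t \<and> (\<forall>d\<in>t. r d \<le> r c')"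
      using exists_max_rank[where r = r] ne by (metis (no_types))
    then obtain k where k: "\<And>t. t \<in> \<B> \<Longrightarrow> k t \<in> t \<and> (\<forall>d\<in>t. r d \<le> r (k t))" by metis
    have "r (k t0) = r c" using k[OF t0(1)] t0(2,4) by (intro antisym) blast+
    then have "k t0 = c" using r(1) by (simp add: inj_eq)
    define \<psi> where "\<psi> w = (\<Sum>t\<in>\<B>. lambda_form N (k t) w) - l w" for w
    have lin: "linear \<psi>" unfolding \<psi>_def[abs_def] by (intro linear_compose_sub linear_sum_lambda_form l)
    have nonneg: "0 \<le> \<psi> w" if "w \<in> C" for w
    proof -
      have "lightcone_function N \<B> w \<le> (\<Sum>t\<in>\<B>. lambda_form N (k t) w)"
        unfolding lightcone_function_def using k by (intro sum_mono Min_le) auto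
      then show ?thesis by (simp add: \<psi>_def l(2)[OF that])
    qed
    have "lambda_form N (k t) v0 \<le> lambda_form N e v0" if "t \<in> \<B>" "e \<in> t" for t e
      using k[OF that(1)] that(2) r(3)[of e "k t"] by (meson not_le)
    then have "lightcone_function N \<B> v0 = (\<Sum>t\<in>\<B>. lambda_form N (k t) v0)"
      using k by (intro lightcone_function_eq) blast
    then have "\<psi> v0 = 0" by (simp add: \<psi>_def l(2)[OF v0C])
    \<comment> \<open>Prolonging the segment from \<open>v\<close> beyond \<open>v0\<close> inside \<open>C\<close> turns \<open>\<psi> v > 0\<close> into a negative
        value.\<close>
    obtain a where a: "a > 1" "(1 - a) *\<^sub>R v + a *\<^sub>R v0 \<in> C"
      using v0 v convex_rel_interior_iff[OF C(1,2)] by blast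
    have "0 \<le> (1 - a) * \<psi> v"
      using nonneg[OF a(2)] \<open>\<psi> v0 = 0\<close> by (simp add: linear_add[OF lin] linear_scale[OF lin])
    then have "\<psi> v \<le> 0" using a(1) by (auto simp: zero_le_mult_iff)
    then have "\<psi> v = 0" using nonneg[OF v] by simp
    then have "(\<Sum>t\<in>\<B>. lambda_form N (k t) v - Min ((\<lambda>e. lambda_form N e v) ` t)) = 0"
      unfolding \<psi>_def l(2)[OF v, symmetric] lightcone_function_def by (simp add: sum_subtractf)
    then have "\<forall>t\<in>\<B>. lambda_form N (k t) v - Min ((\<lambda>e. lambda_form N e v) ` t) = 0"
      using k by (subst (asm) sum_nonneg_eq_0_iff) auto
    then have "lambda_form N c v = Min ((\<lambda>e. lambda_form N e v) ` t0)" using t0 \<open>k t0 = c\<close> by auto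
    then show ?thesis using t0 by simp
  qed
  show ?thesis
  proof (rule that[OF r(1,2)])
    show "C \<subseteq> chamber N \<B> r" using C(3) sub by (auto simp: chamber_def)
    assume "\<And>v e. v \<in> C \<Longrightarrow> e \<in> N \<Longrightarrow> lambda_form N e0 v \<le> lambda_form N e v"
    then show "\<forall>e\<in>N. r e \<le> r e0" using r(4) v0C by blast
  qed
qed

lemma linear_subset_some_chamber:
  fixes N :: "'a::{finite,complete_lattice} set"
  assumes "convex C" "C \<noteq> {}" "C \<subseteq> nested_cone N" "\<And>t. t \<in> \<B> \<Longrightarrow> t \<noteq> {}"
    and "linear l" "\<And>v. v \<in> C \<Longrightarrow> lightcone_function N \<B> v = l v"
  shows "\<exists>r. C \<subseteq> chamber N \<B> r"
  using linear_subset_chamber[OF assms] by metis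

text \<open>
Consequently a cone of the subdivision for \<open>N'\<close> lies in a linearity domain for every nested
\<open>N \<supseteq> N'\<close>, and only maximal nested sets contribute maximal cones.
\<close>

lemma linear_on_larger_cone:
  assumes bs: "building_set G" and nest: "nested G N" and sub: "N' \<subseteq> N"
    and \<B>: "\<And>t. t \<in> \<B> \<Longrightarrow> t \<noteq> {} \<and> t \<subseteq> N \<and> connected_edge_set N t"
    and D: "convex D" "D \<noteq> {}" "D \<subseteq> nested_cone N'"
    and l: "linear l" "\<And>v. v \<in> D \<Longrightarrow> lightcone_function N' {t \<inter> N' |t. t \<in> \<B> \<and> t \<inter> N' \<noteq> {}} v = l v"
  shows "\<exists>l. linear l \<and> (\<forall>v\<in>D. lightcone_function N \<B> v = l v)"
proof -
  obtain r :: "_ \<Rightarrow> real" where r: "D \<subseteq> chamber N' {t \<inter> N' |t. t \<in> \<B> \<and> t \<inter> N' \<noteq> {}} r"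
    using linear_subset_some_chamber[OF D _ l] by blast
  have "\<exists>c. c \<in> t \<and> (\<forall>v\<in>D. \<forall>e\<in>t. lambda_form N c v \<le> lambda_form N e v)" if t: "t \<in> \<B>" for t
  proof (cases "t \<inter> N' = {}")
    case True
    obtain c where "c \<in> t" using \<B>[OF t] by auto
    then show ?thesis
      using lambda_form_constant_off_face[OF bs nest _ _ _ _ _ True] \<B>[OF t] D(3) by (metis order_refl subsetD)
  next
    case False
    obtain c where c: "c \<in> t \<inter> N'" "\<forall>d\<in>t \<inter> N'. r d \<le> r c" using exists_max_rank[OF False] by blast
    have "lambda_form N c v \<le> lambda_form N e v" if v: "v \<in> D" and e: "e \<in> t" for v e
    proof -
      have vN: "v \<in> nested_cone N'" using v D by auto
      obtain d where d: "d \<in> t \<inter> N'" "lambda_form N d v \<le> lambda_form N e v"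
        using lambda_form_min_on_face[OF bs nest _ _ vN e False] \<B>[OF t] by auto
      have "lambda_form N' c v \<le> lambda_form N' d v"
        using r v t False c d(1) unfolding chamber_def by blast
      then show ?thesis using d(2) by (simp add: lambda_form_subset[OF sub vN])
    qed
    then show ?thesis using c by blast
  qed
  then obtain c where c: "\<And>t. t \<in> \<B> \<Longrightarrow> c t \<in> t \<and> (\<forall>v\<in>D. \<forall>e\<in>t. lambda_form N (c t) v \<le> lambda_form N e v)"
    by metis
  have "lightcone_function N \<B> v = (\<Sum>t\<in>\<B>. lambda_form N (c t) v)" if "v \<in> D" for v
    by (rule lightcone_function_eq) (use c that in auto)
  then show ?thesis using linear_sum_lambda_form by blast
qed

section \<open>Diagonal points\<close>

definition ranking_point :: "'a::{finite,complete_lattice} set \<Rightarrow> ('a \<Rightarrow> real) \<Rightarrow> 'a coords" where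
  "ranking_point N r = (\<chi> f. if f \<in> N then r f else 0)"

lemma ranking_point_coord_space: "N \<subseteq> G \<Longrightarrow> ranking_point N r \<in> coord_space G"
  by (auto simp: ranking_point_def coord_space_def)

lemma pco_ranking: "N \<subseteq> G \<Longrightarrow> pco f (Delta0 G (ranking_point N r)) = (if f \<in> N then r f else 0)"
  by (auto simp: pco_Delta0 ranking_point_def)

lemma mco_ranking:
  "N \<subseteq> G \<Longrightarrow> mco f (Delta0 G (ranking_point N r)) = (if f \<in> N \<and> f \<noteq> top then r f else 0)"
  by (auto simp: mco_Delta0 ranking_point_def)

text \<open>
On the diagonal the forms are, up to a common constant, the negated coordinates.  Every
ranking is therefore realised by a diagonal point, and that point has a unique minimiser in each
member of the Boolean building set.
\<close>

lemma lambda_form_ranking: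
  assumes bs: "building_set G" and nest: "nested G N" and e: "e \<in> N"
  shows "lambda_form N e (Delta0 G (ranking_point N r)) = sum r N - r e"
proof -
  have NG: "N \<subseteq> G" using nest by (rule nested_imp_subset)
  have "lambda_form N e (Delta0 G (ranking_point N r)) =
      (\<Sum>f | f \<in> N \<and> e < f. r f) + (\<Sum>f | f \<in> N \<and> \<not> e \<le> f. r f)"
    unfolding lambda_form_nested[OF assms] by (auto simp: pco_ranking[OF NG] mco_ranking[OF NG] intro!: sum.cong arg_cong2[of _ _ _ _ "(+)"])
  also have "\<dots> = sum r ({f. f \<in> N \<and> e < f} \<union> {f. f \<in> N \<and> \<not> e \<le> f})"
    by (subst sum.union_disjoint) auto
  also have "{f. f \<in> N \<and> e < f} \<union> {f. f \<in> N \<and> \<not> e \<le> f} = N - {e}" by auto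
  finally show ?thesis using e by (simp add: sum_diff1)
qed

lemma ranking_point_in_chamber:
  assumes bs: "building_set G" and nest: "nested G N" and \<B>: "\<And>t. t \<in> \<B> \<Longrightarrow> t \<subseteq> N"
    and pos: "\<And>e. 0 < r e"
  shows "Delta0 G (ranking_point N r) \<in> chamber N \<B> r"
proof -
  have NG: "N \<subseteq> G" using nest by (rule nested_imp_subset)
  have "Delta0 G (ranking_point N r) \<in> nested_cone N"
    using pos by (auto simp: nested_cone_iff pco_ranking[OF NG] mco_ranking[OF NG] intro: less_imp_le)
  then show ?thesis unfolding chamber_def using \<B>
    by (auto simp: lambda_form_ranking[OF bs nest] subset_iff)
qed

text \<open>
The minimisers of \<open>\<lambda>\<close> at the diagonal point of \<open>r\<close> are unique, so any ranking \<open>r'\<close> whose chamber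
contains this point has the same top-ranked elements as \<open>r\<close>.
\<close>

lemma chamber_eq_of_ranking_point:
  assumes bs: "building_set G" and nest: "nested G N" and \<B>: "\<And>t. t \<in> \<B> \<Longrightarrow> t \<noteq> {} \<and> t \<subseteq> N"
    and inj: "inj r" and mem: "Delta0 G (ranking_point N r) \<in> chamber N \<B> r'"
  shows "chamber N \<B> r' = chamber N \<B> r"
proof -
  have max: "r e \<le> r c" if "t \<in> \<B>" "c \<in> t" "e \<in> t" "\<forall>d\<in>t. r' d \<le> r' c" for t c e
  proof -
    have "lambda_form N c (Delta0 G (ranking_point N r)) \<le> lambda_form N e (Delta0 G (ranking_point N r))"
      using mem that unfolding chamber_def by blast
    then show ?thesis using that \<B>[OF that(1)] by (auto simp: lambda_form_ranking[OF bs nest] subset_iff)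
  qed
  have "(\<forall>d\<in>t. r' d \<le> r' c) \<longleftrightarrow> (\<forall>d\<in>t. r d \<le> r c)" if t: "t \<in> \<B>" "c \<in> t" for t c
  proof
    show "\<forall>d\<in>t. r' d \<le> r' c \<Longrightarrow> \<forall>d\<in>t. r d \<le> r c" using max[OF t] by blast
    assume c: "\<forall>d\<in>t. r d \<le> r c"
    obtain c' where c': "c' \<in> t" "\<forall>d\<in>t. r' d \<le> r' c'" using exists_max_rank[of t r'] \<B>[OF t(1)] by auto
    then have "r c' = r c" using max[OF t(1) c'(1) t(2)] c by (auto intro: antisym)
    then have "c' = c" using inj by (simp add: inj_eq)
    then show "\<forall>d\<in>t. r' d \<le> r' c" using c' by simp
  qed
  then show ?thesis unfolding chamber_def by (intro Collect_cong) auto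
qed

lemma subset_of_ranking_point:
  assumes "N \<subseteq> G" "\<And>e. 0 < r e" "Delta0 G (ranking_point N r) \<in> nested_cone N'"
  shows "N \<subseteq> N'"
proof
  fix f assume "f \<in> N"
  then have "pco f (Delta0 G (ranking_point N r)) \<noteq> 0"
    using pco_ranking[OF assms(1)] assms(2)[of f] by simp
  then show "f \<in> N'" using assms(3) by (auto simp: nested_cone_iff)
qed

lemma linearity_domain_eq_chamber:
  assumes bs: "building_set G" and nest: "nested G N" and \<B>: "\<And>t. t \<in> \<B> \<Longrightarrow> t \<noteq> {} \<and> t \<subseteq> N"
    and D: "D \<in> linearity_domains (lightcone_function N \<B>) (nested_cone N)"
    and z: "Delta0 G (ranking_point N r) \<in> D" "inj r"
  shows "D = chamber N \<B> r"
proof -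
  from D obtain l where l: "D \<subseteq> nested_cone N" "convex D" "linear l" "\<forall>v\<in>D. lightcone_function N \<B> v = l v"
    and max: "\<And>D'. D' \<subseteq> nested_cone N \<Longrightarrow> convex D' \<Longrightarrow>
      (\<exists>l. linear l \<and> (\<forall>v\<in>D'. lightcone_function N \<B> v = l v)) \<Longrightarrow> D \<subseteq> D' \<Longrightarrow> D' = D"
    unfolding linearity_domains_def maximal_elements_def by auto
  obtain r' :: "_ \<Rightarrow> real" where r': "D \<subseteq> chamber N \<B> r'"
    using linear_subset_some_chamber[of D N \<B> l] l z \<B> by auto
  then have "chamber N \<B> r' = chamber N \<B> r"
    using chamber_eq_of_ranking_point[OF bs nest \<B> z(2)] z(1) by blast
  then have "D \<subseteq> chamber N \<B> r" using r' by simp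
  moreover have "chamber N \<B> r \<subseteq> nested_cone N" by (auto simp: chamber_def)
  ultimately show ?thesis
    using max[OF _ convex_chamber chamber_linear] \<B> by blast
qed

lemma chamber_linearity_domain:
  assumes bs: "building_set G" and nest: "nested G N" and \<B>: "\<And>t. t \<in> \<B> \<Longrightarrow> t \<noteq> {} \<and> t \<subseteq> N"
    and r: "inj r" "\<And>e. 0 < r e"
  shows "chamber N \<B> r \<in> linearity_domains (lightcone_function N \<B>) (nested_cone N)"
proof -
  have z: "Delta0 G (ranking_point N r) \<in> chamber N \<B> r"
    using \<B> by (intro ranking_point_in_chamber[OF bs nest _ r(2)]) blast
  have unique: "D = chamber N \<B> r" if D: "D \<subseteq> nested_cone N" "convex D" "linear l"
      "\<forall>v\<in>D. lightcone_function N \<B> v = l v" "chamber N \<B> r \<subseteq> D" for D l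
  proof -
    obtain r' :: "_ \<Rightarrow> real" where r': "D \<subseteq> chamber N \<B> r'"
      using linear_subset_some_chamber[of D N \<B> l] D z \<B> by auto
    then have "Delta0 G (ranking_point N r) \<in> chamber N \<B> r'" using z D by blast
    then have "chamber N \<B> r' = chamber N \<B> r"
      by (intro chamber_eq_of_ranking_point[OF bs nest \<B> r(1)])
    then show ?thesis using r' D by blast
  qed
  moreover have "chamber N \<B> r \<subseteq> nested_cone N" by (auto simp: chamber_def)
  moreover have "\<exists>l. linear l \<and> (\<forall>v\<in>chamber N \<B> r. lightcone_function N \<B> v = l v)"
    using \<B> by (intro chamber_linear) blast
  ultimately show ?thesis
    using convex_chamber[of N \<B> r]
    unfolding linearity_domains_def maximal_elements_def mem_Collect_eq
    by (intro conjI ballI impI) (auto dest: unique)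
qed

section \<open>Bijections between maximal cones\<close>

lemma Delta0_in_nested_cone:
  assumes "x \<in> coord_space G" "Delta0 G x \<in> nested_cone N"
  shows "0 \<le> x $ f" "supp x \<subseteq> N"
proof -
  have eq: "x $ f = pco f (Delta0 G x)" for f using assms(1) by (auto simp: pco_Delta0 coord_space_def)
  show "0 \<le> x $ f" "supp x \<subseteq> N" using assms(2) by (auto simp: eq supp_def nested_cone_iff)
qed

text \<open>
\<open>p\<close> is injective on the support of the nested set fan, which is the preimage of the support of
\<open>\<Sigma>\<close> under \<open>\<Delta>\<^sub>0\<close>.
\<close>

lemma atom_map_inject:
  fixes G :: "'a::{finite,complete_lattice} set"
  assumes at: "atomic_lattice TYPE('a)" and bs: "building_set G"
    and x: "x \<in> coord_space G" "Delta0 G x \<in> nested_cone N" "nested G N"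
    and y: "y \<in> coord_space G" "Delta0 G y \<in> nested_cone N'" "nested G N'"
    and eq: "atom_map G x = atom_map G y"
  shows "x = y"
proof (rule atom_sum_inject[OF at bs])
  show "0 \<le> x $ f" "0 \<le> y $ f" for f using Delta0_in_nested_cone(1) x y by blast+
  show "nested G (supp x)" "nested G (supp y)"
    using Delta0_in_nested_cone(2) x y nested_subset by blast+
  show "atom_sum x e = atom_sum y e" if "e \<in> atoms" for e
    using atom_map_nth[OF x(1) that] atom_map_nth[OF y(1) that] eq by simp
qed

text \<open>
It suffices that every cone lies in a cone \<open>W\<close> with a diagonal point that belongs to no cone
outside \<open>W\<close>.  By injectivity of \<open>p\<close> the image of this point detects \<open>W\<close>, so containment between
images of a maximal cone and another cone is containment between the cones themselves.
\<close>

lemma bij_betw_maximal_cones: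
  fixes G :: "'a::{finite,complete_lattice} set"
  assumes at: "atomic_lattice TYPE('a)" and bs: "building_set G"
    and fan: "\<And>C. C \<in> \<Gamma> \<Longrightarrow> \<exists>N. nested G N \<and> C \<subseteq> nested_cone N"
    and wit: "\<And>C. C \<in> \<Gamma> \<Longrightarrow> \<exists>W\<in>\<Gamma>. C \<subseteq> W \<and>
      (\<exists>x\<in>coord_space G. Delta0 G x \<in> W \<and> (\<forall>D\<in>\<Gamma>. Delta0 G x \<in> D \<longrightarrow> D \<subseteq> W))"
  shows "bij_betw (proj_cone G) (maximal_elements \<Gamma>) (maximal_elements (proj_cone G ` \<Gamma>))"
proof -
  have mono: "proj_cone G C \<subseteq> proj_cone G D" if "C \<subseteq> D" for C D
    using that by (auto simp: proj_cone_def)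
  have reflect: "D \<subseteq> C"
    if C: "C \<in> maximal_elements \<Gamma>" and D: "D \<in> \<Gamma>" and sub: "proj_cone G C \<subseteq> proj_cone G D" for C D
  proof -
    have C\<Gamma>: "C \<in> \<Gamma>" using C by (simp add: maximal_elements_def)
    from wit[OF C\<Gamma>] obtain W x where W: "W \<in> \<Gamma>" "C \<subseteq> W" and x: "x \<in> coord_space G" "Delta0 G x \<in> W"
      and all: "\<forall>D\<in>\<Gamma>. Delta0 G x \<in> D \<longrightarrow> D \<subseteq> W" by blast
    have "W = C" using C W by (simp add: maximal_elements_def)
    then have "atom_map G x \<in> proj_cone G C" using x by (auto simp: proj_cone_def)
    then obtain y where y: "y \<in> coord_space G" "Delta0 G y \<in> D" "atom_map G x = atom_map G y"
      using sub by (auto simp: proj_cone_def)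
    obtain N N' where "nested G N" "W \<subseteq> nested_cone N" "nested G N'" "D \<subseteq> nested_cone N'"
      using fan W(1) D by meson
    then have "x = y" using atom_map_inject[OF at bs] x y by blast
    then show ?thesis using all D y \<open>W = C\<close> by auto
  qed
  have above: "\<exists>W\<in>maximal_elements \<Gamma>. C \<subseteq> W" if "C \<in> \<Gamma>" for C
  proof -
    from wit[OF that] obtain W x where "W \<in> \<Gamma>" "C \<subseteq> W" "Delta0 G x \<in> W"
      and all: "\<forall>D\<in>\<Gamma>. Delta0 G x \<in> D \<longrightarrow> D \<subseteq> W" by blast
    then have "W \<in> maximal_elements \<Gamma>" by (auto simp: maximal_elements_def)
    then show ?thesis using \<open>C \<subseteq> W\<close> by blast
  qed
  have max_in: "C \<in> \<Gamma>" if "C \<in> maximal_elements \<Gamma>" for C using that by (simp add: maximal_elements_def)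
  show ?thesis
    unfolding bij_betw_def
  proof
    show "inj_on (proj_cone G) (maximal_elements \<Gamma>)"
      by (intro inj_onI subset_antisym reflect) (auto simp: max_in)
    show "proj_cone G ` maximal_elements \<Gamma> = maximal_elements (proj_cone G ` \<Gamma>)"
    proof (intro subset_antisym subsetI)
      fix P assume "P \<in> proj_cone G ` maximal_elements \<Gamma>"
      then obtain C where C: "P = proj_cone G C" "C \<in> maximal_elements \<Gamma>" by auto
      have "Q = P" if "Q \<in> proj_cone G ` \<Gamma>" "P \<subseteq> Q" for Q
        using that reflect[OF C(2)] mono C(1) by (metis imageE subset_antisym)
      then show "P \<in> maximal_elements (proj_cone G ` \<Gamma>)"
        unfolding maximal_elements_def using C max_in by blast
    next
      fix P assume P: "P \<in> maximal_elements (proj_cone G ` \<Gamma>)"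
      then obtain D where D: "P = proj_cone G D" "D \<in> \<Gamma>" by (auto simp: maximal_elements_def)
      obtain C where C: "C \<in> maximal_elements \<Gamma>" "D \<subseteq> C" using above[OF D(2)] by auto
      have "proj_cone G C = P"
        using P mono[OF C(2)] D(1) max_in[OF C(1)] by (auto simp: maximal_elements_def)
      then show "P \<in> proj_cone G ` maximal_elements \<Gamma>" using C(1) by blast
    qed
  qed
qed

section \<open>Lightcone fans\<close>

lemma lightcone_choiceD:
  assumes "lightcone_choice G B" "nested G N"
  shows "\<And>t. t \<in> B N \<Longrightarrow> t \<noteq> {} \<and> t \<subseteq> N"
    and "\<And>t. t \<in> B N \<Longrightarrow> connected_edge_set N t"
    and "\<And>N'. N' \<subseteq> N \<Longrightarrow> B N' = {t \<inter> N' |t. t \<in> B N \<and> t \<inter> N' \<noteq> {}}"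
proof -
  note * = assms(1)[unfolded lightcone_choice_def, THEN spec, THEN mp, OF assms(2)]
  show "\<And>t. t \<in> B N \<Longrightarrow> t \<noteq> {} \<and> t \<subseteq> N"
    using *[THEN conjunct1] by (simp add: boolean_building_set_def)
  show "\<And>t. t \<in> B N \<Longrightarrow> connected_edge_set N t"
    by (rule *[THEN conjunct2, THEN conjunct1, THEN bspec])
  show "\<And>N'. N' \<subseteq> N \<Longrightarrow> B N' = {t \<inter> N' |t. t \<in> B N \<and> t \<inter> N' \<noteq> {}}"
    by (rule *[THEN conjunct2, THEN conjunct2, THEN spec, THEN mp])
qed

lemma lightcone_fanE:
  assumes "C \<in> lightcone_fan G B"
  obtains N D l where "nested G N" "D \<in> linearity_domains (lightcone_function N (B N)) (nested_cone N)"
    "C face_of D" "C \<noteq> {}" "convex C" "C \<subseteq> nested_cone N"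
    "linear l" "\<And>v. v \<in> C \<Longrightarrow> lightcone_function N (B N) v = l v"
proof -
  from assms obtain N D where N: "nested G N" "C \<noteq> {}" "C face_of D"
    and D: "D \<in> linearity_domains (lightcone_function N (B N)) (nested_cone N)"
    unfolding lightcone_fan_def lightcone_subdivision_def all_faces_def by blast
  from D obtain l where l: "D \<subseteq> nested_cone N" "linear l" "\<forall>v\<in>D. lightcone_function N (B N) v = l v"
    unfolding linearity_domains_def maximal_elements_def by blast
  have "C \<subseteq> D" using N(3) by (rule face_of_imp_subset)
  then show ?thesis using that[OF N(1) D N(3,2) face_of_imp_convex[OF N(3)] _ l(2)] l by blast
qed

lemma lightcone_fan_in_nested_cone:
  assumes "C \<in> lightcone_fan G B"
  shows "\<exists>N. nested G N \<and> C \<subseteq> nested_cone N"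
  using lightcone_fanE[OF assms] by metis

lemma lightcone_fan_subset_chamber:
  fixes G :: "'a::{finite,complete_lattice} set"
  assumes bs: "building_set G" and ch: "lightcone_choice G B" and C: "C \<in> lightcone_fan G B"
  obtains N r where "nested G N" "\<And>M. nested G M \<Longrightarrow> N \<subseteq> M \<Longrightarrow> M = N"
    "inj r" "\<And>e. 0 < r e" "C \<subseteq> chamber N (B N) r"
    "(\<And>v e. v \<in> C \<Longrightarrow> e \<in> N \<Longrightarrow> lambda_form N top v \<le> lambda_form N e v) \<Longrightarrow> \<forall>e\<in>N. r e \<le> r top"
proof -
  obtain N' l where N': "nested G N'" and c: "convex C" "C \<noteq> {}" "C \<subseteq> nested_cone N'"
    and l: "linear l" "\<And>v. v \<in> C \<Longrightarrow> lightcone_function N' (B N') v = l v"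
    using lightcone_fanE[OF C] by metis
  obtain N where N: "nested G N" "N' \<subseteq> N" and max: "\<And>M. nested G M \<Longrightarrow> N \<subseteq> M \<Longrightarrow> M = N"
    using nested_maximal_superset[OF N'] by metis
  note chN = lightcone_choiceD[OF ch N(1)]
  obtain k where k: "linear k" "\<And>v. v \<in> C \<Longrightarrow> lightcone_function N (B N) v = k v"
    using linear_on_larger_cone[OF bs N(1,2) _ c l(1) l(2)[unfolded chN(3)[OF N(2)]]] chN(1,2) by metis
  have "C \<subseteq> nested_cone N" using c(3) nested_cone_mono[OF N(2)] by blast
  from linear_subset_chamber[OF c(1,2) this _ k, of top] chN(1)
  obtain r where "inj r" "\<And>e. 0 < r e" "C \<subseteq> chamber N (B N) r"
    "(\<And>v e. v \<in> C \<Longrightarrow> e \<in> N \<Longrightarrow> lambda_form N top v \<le> lambda_form N e v) \<Longrightarrow> \<forall>e\<in>N. r e \<le> r top"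
    by metis
  then show ?thesis using that[OF N(1) max] by blast
qed

lemma chamber_in_lightcone_fan:
  assumes bs: "building_set G" and ch: "lightcone_choice G B" and N: "nested G N"
    and r: "inj r" "\<And>e. 0 < r e"
  shows "chamber N (B N) r \<in> lightcone_fan G B"
proof -
  note B = lightcone_choiceD(1)[OF ch N]
  have "Delta0 G (ranking_point N r) \<in> chamber N (B N) r"
    by (rule ranking_point_in_chamber[OF bs N]) (use B r in auto)
  then have "chamber N (B N) r \<noteq> {}" by blast
  moreover have "chamber N (B N) r face_of chamber N (B N) r" by (rule face_of_refl[OF convex_chamber])
  moreover have "chamber N (B N) r \<in> linearity_domains (lightcone_function N (B N)) (nested_cone N)"
    by (rule chamber_linearity_domain[OF bs N]) (use B r in auto)
  ultimately show ?thesis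
    using N unfolding lightcone_fan_def lightcone_subdivision_def all_faces_def by blast
qed

text \<open>
The diagonal point has positive coordinates on all of \<open>N\<close>, so a fan cone through it comes from a
nested set containing \<open>N\<close>, that is, from \<open>N\<close>; and within \<open>N\<close> the point lies in one linearity
domain only.
\<close>

lemma fan_cone_at_ranking_point:
  assumes bs: "building_set G" and ch: "lightcone_choice G B" and N: "nested G N"
    and max: "\<And>M. nested G M \<Longrightarrow> N \<subseteq> M \<Longrightarrow> M = N" and r: "inj r" "\<And>e. 0 < r e"
    and D: "D \<in> lightcone_fan G B" "Delta0 G (ranking_point N r) \<in> D"
  shows "D face_of chamber N (B N) r"
proof -
  obtain N' D' where N': "nested G N'" "D' \<in> linearity_domains (lightcone_function N' (B N')) (nested_cone N')"
    "D face_of D'" "D \<subseteq> nested_cone N'"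
    using lightcone_fanE[OF D(1)] by metis
  have "N \<subseteq> N'"
    by (rule subset_of_ranking_point[OF nested_imp_subset[OF N], of r]) (use r D(2) N'(4) in auto)
  then have "N' = N" using max N'(1) by blast
  have "Delta0 G (ranking_point N r) \<in> D'" using D(2) face_of_imp_subset[OF N'(3)] by blast
  moreover have "D' \<in> linearity_domains (lightcone_function N (B N)) (nested_cone N)"
    using N'(2) by (simp add: \<open>N' = N\<close>)
  ultimately have "D' = chamber N (B N) r"
    using linearity_domain_eq_chamber[OF bs N lightcone_choiceD(1)[OF ch N]] r(1) by blast
  then show ?thesis using N'(3) by simp
qed

text \<open>
The only inequality of the chamber that is tight at the diagonal point is \<open>m\<^bsub>top\<^esub> \<ge> 0\<close>.  The
point lies therefore in the relative interior of the part of the chamber where \<open>m\<^bsub>top\<^esub>\<close>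
vanishes, and a face through it contains this whole part.
\<close>

lemma ranking_point_relative_interior:
  assumes bs: "building_set G" and N: "nested G N" and \<B>: "\<And>t. t \<in> \<B> \<Longrightarrow> t \<subseteq> N"
    and r: "inj r" "\<And>e. 0 < r e"
    and E: "E face_of chamber N \<B> r" "Delta0 G (ranking_point N r) \<in> E"
    and v: "v \<in> chamber N \<B> r" "mco top v = 0"
  shows "v \<in> E"
proof -
  define z where "z = Delta0 G (ranking_point N r)"
  note NG = nested_imp_subset[OF N]
  define w where "w s = z + s *\<^sub>R (z - v)" for s
  have lim: "\<forall>\<^sub>F s in at_right 0. 0 < a + s * b" if "0 < a" for a b :: real
  proof -
    have "((\<lambda>s. a + s * b) \<longlongrightarrow> a + 0 * b) (at_right 0)" by (intro tendsto_intros)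
    then show ?thesis using that by (intro order_tendstoD(1)) auto
  qed
  \<comment> \<open>The ray from \<open>v\<close> through \<open>z\<close> stays in the chamber for a while beyond \<open>z\<close>, because finitely
      many strict inequalities hold at \<open>z\<close>.\<close>
  have 1: "\<forall>\<^sub>F s in at_right 0. \<forall>f\<in>N. 0 < pco f z + s * (pco f z - pco f v)"
    by (intro eventually_ball_finite finite ballI lim) (simp add: z_def pco_ranking[OF NG] r)
  have 2: "\<forall>\<^sub>F s in at_right 0. \<forall>f\<in>N - {top}. 0 < mco f z + s * (mco f z - mco f v)"
    by (intro eventually_ball_finite finite ballI lim) (simp add: z_def mco_ranking[OF NG] r)
  have 3: "\<forall>\<^sub>F s in at_right 0. \<forall>p\<in>{p \<in> N \<times> N. r (fst p) > r (snd p)}.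
      0 < (lambda_form N (snd p) z - lambda_form N (fst p) z) +
        s * ((lambda_form N (snd p) z - lambda_form N (fst p) z) -
             (lambda_form N (snd p) v - lambda_form N (fst p) v))"
    by (intro eventually_ball_finite finite ballI lim) (auto simp: z_def lambda_form_ranking[OF bs N])
  have "\<forall>\<^sub>F s::real in at_right 0. 0 < s" by (simp add: eventually_at_right_less)
  with 1 2 3 have "\<forall>\<^sub>F s in at_right 0. 0 < s \<and> w s \<in> chamber N \<B> r"
  proof eventually_elim
    case (elim s)
    have p: "pco f (w s) = pco f z + s * (pco f z - pco f v)"
      "mco f (w s) = mco f z + s * (mco f z - mco f v)" for f
      by (simp_all add: w_def pco_simps mco_simps)
    have l: "lambda_form N e (w s) = lambda_form N e z + s * (lambda_form N e z - lambda_form N e v)" for e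
      by (simp add: w_def linear_add[OF linear_lambda_form] linear_scale[OF linear_lambda_form]
          linear_diff[OF linear_lambda_form])
    have vN: "v \<in> nested_cone N" using v by (simp add: chamber_def)
    have out: "pco f z = 0" "mco f z = 0" "pco f v = 0" "mco f v = 0" if "f \<notin> N" for f
      using that vN by (auto simp: z_def pco_ranking[OF NG] mco_ranking[OF NG] nested_cone_iff)
    have "mco top z = 0" by (simp add: z_def mco_ranking[OF NG])
    then have "w s \<in> nested_cone N"
      unfolding nested_cone_iff p using elim(1,2) out v(2)
      by (metis DiffI add.right_neutral diff_zero less_imp_le mult_zero_right order_refl singletonD)
    moreover have "lambda_form N c (w s) \<le> lambda_form N e (w s)"
      if t: "t \<in> \<B>" "c \<in> t" "e \<in> t" "\<forall>d\<in>t. r d \<le> r c" for t c e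
    proof (cases "c = e")
      case False
      then have "r e < r c" using t(3,4) r(1) by (metis inj_eq le_less)
      then have "(c, e) \<in> {p \<in> N \<times> N. r (fst p) > r (snd p)}" using t \<B> by auto
      with elim(3) have "0 < (lambda_form N e z - lambda_form N c z) +
        s * ((lambda_form N e z - lambda_form N c z) - (lambda_form N e v - lambda_form N c v))"
        by fastforce
      then show ?thesis unfolding l by (simp add: algebra_simps)
    qed simp
    ultimately show ?case using elim(4) by (auto simp: chamber_def)
  qed
  then obtain s where s: "0 < s" "w s \<in> chamber N \<B> r"
    by (metis (mono_tags, lifting) eventually_happens trivial_limit_at_right_real)
  show ?thesis
  proof (cases "v = z")
    case True
    then show ?thesis using E(2) by (simp add: z_def)
  next
    case False
    have "z = (1 - s / (1 + s)) *\<^sub>R w s + (s / (1 + s)) *\<^sub>R v"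
    proof -
      have "(1 + s) *\<^sub>R z = w s + s *\<^sub>R v" by (simp add: w_def algebra_simps)
      then have "(1 / (1 + s)) *\<^sub>R ((1 + s) *\<^sub>R z) = (1 / (1 + s)) *\<^sub>R (w s + s *\<^sub>R v)" by simp
      moreover have "1 - s / (1 + s) = 1 / (1 + s)" using s(1) by (simp add: field_simps)
      ultimately show ?thesis using s(1) by (simp add: scaleR_add_right)
    qed
    moreover have "w s \<noteq> v"
    proof
      assume "w s = v"
      then have "(1 + s) *\<^sub>R (z - v) = 0" by (simp add: w_def algebra_simps)
      then show False using s(1) False by simp
    qed
    moreover have "0 < s / (1 + s)" "s / (1 + s) < 1" using s(1) by (auto simp: field_simps)
    ultimately have "z \<in> open_segment (w s) v" unfolding in_segment by blast
    then show ?thesis using face_ofD[OF E(1) _ s(2) v(1)] E(2) by (simp add: z_def)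
  qed
qed

lemma bij_betw_maximal_cones_Sigma:
  fixes G :: "'a::{finite,complete_lattice} set"
  assumes at: "atomic_lattice TYPE('a)" and bs: "building_set G"
    and "lightcone_refinement_Sigma G \<Gamma>"
  shows "bij_betw (proj_cone G) (maximal_elements \<Gamma>) (maximal_elements (proj_cone G ` \<Gamma>))"
proof -
  obtain B where ch: "lightcone_choice G B" and \<Gamma>: "\<Gamma> = lightcone_fan G B"
    using assms(3) by (auto simp: lightcone_refinement_Sigma_def)
  show ?thesis
  proof (rule bij_betw_maximal_cones[OF at bs])
    fix C assume C: "C \<in> \<Gamma>"
    then show "\<exists>N. nested G N \<and> C \<subseteq> nested_cone N" unfolding \<Gamma> by (blast intro: lightcone_fan_in_nested_cone)
    from lightcone_fan_subset_chamber[OF bs ch C[unfolded \<Gamma>]]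
    obtain N r where N: "nested G N" "\<And>M. nested G M \<Longrightarrow> N \<subseteq> M \<Longrightarrow> M = N"
      and r: "inj r" "\<And>e. 0 < r e" and sub: "C \<subseteq> chamber N (B N) r"
      by metis
    let ?W = "chamber N (B N) r"
    have "D \<subseteq> ?W" if "D \<in> \<Gamma>" "Delta0 G (ranking_point N r) \<in> D" for D
      using fan_cone_at_ranking_point[OF bs ch N r] that \<Gamma> by (metis face_of_imp_subset)
    moreover have "?W \<in> \<Gamma>" using chamber_in_lightcone_fan[OF bs ch N(1) r] \<Gamma> by simp
    moreover have "Delta0 G (ranking_point N r) \<in> ?W"
      by (rule ranking_point_in_chamber[OF bs N(1)]) (use lightcone_choiceD(1)[OF ch N(1)] r in auto)
    ultimately show "\<exists>W\<in>\<Gamma>. C \<subseteq> W \<and>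
      (\<exists>x\<in>coord_space G. Delta0 G x \<in> W \<and> (\<forall>D\<in>\<Gamma>. Delta0 G x \<in> D \<longrightarrow> D \<subseteq> W))"
      using sub ranking_point_coord_space[OF nested_imp_subset[OF N(1)], of r] by blast
  qed
qed

section \<open>The universe fan\<close>

text \<open>
On the cone of \<open>N\<close> the causal inequalities say that \<open>\<lambda>\<close> is smallest at \<open>top\<close>.
\<close>

lemma causal_form_lambda:
  assumes bs: "building_set G" and N: "nested G N" and t: "top \<in> N" and g: "g \<in> N" "g \<noteq> top"
    and v: "v \<in> nested_cone N"
  shows "causal_form G g v = lambda_form N g v - lambda_form N top v"
proof -
  let ?I = "{f. f \<in> N \<and> g < f \<and> f < top}"
  have NG: "N \<subseteq> G" using N by (rule nested_imp_subset)
  have "(\<Sum>f\<in>{f\<in>G. g < f \<and> f < top}. pco f v - mco f v) = (\<Sum>f\<in>?I. pco f v - mco f v)"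
    using NG v by (intro sum.mono_neutral_right) (auto simp: nested_cone_iff)
  then have F: "causal_form G g v = pco top v + sum (\<lambda>f. pco f v) ?I - sum (\<lambda>f. mco f v) ?I - mco g v"
    by (simp add: causal_form_def sum_subtractf)
  have "{f. f \<in> N \<and> g < f} = insert top ?I"
    using t g by (auto simp: less_top)
  then have P: "(\<Sum>f | f \<in> N \<and> g < f. pco f v) = pco top v + sum (\<lambda>f. pco f v) ?I" by simp
  have "{f. f \<in> N \<and> \<not> top \<le> f} = insert g (?I \<union> {f. f \<in> N \<and> \<not> g \<le> f})"
    using g by (auto simp: top_unique less_top[symmetric] less_le)
  then have "(\<Sum>f | f \<in> N \<and> \<not> top \<le> f. mco f v) = mco g v + sum (\<lambda>f. mco f v) (?I \<union> {f. f \<in> N \<and> \<not> g \<le> f})"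
    by simp
  also have "sum (\<lambda>f. mco f v) (?I \<union> {f. f \<in> N \<and> \<not> g \<le> f}) =
      sum (\<lambda>f. mco f v) ?I + (\<Sum>f | f \<in> N \<and> \<not> g \<le> f. mco f v)"
    by (rule sum.union_disjoint) auto
  finally have M: "(\<Sum>f | f \<in> N \<and> \<not> top \<le> f. mco f v) =
      mco g v + (sum (\<lambda>f. mco f v) ?I + (\<Sum>f | f \<in> N \<and> \<not> g \<le> f. mco f v))" .
  show ?thesis
    unfolding F lambda_form_nested[OF bs N g(1)] lambda_form_nested[OF bs N t] P M by simp
qed

text \<open>
On the diagonal the sums \<open>p\<^sub>f - m\<^sub>f\<close> in the causal forms cancel, and \<open>F\<^sub>g\<close> becomes the
coordinate at \<open>top\<close> minus the coordinate at \<open>g\<close>.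
\<close>

lemma Delta0_causal:
  assumes x: "x \<in> coord_space G" and pos: "\<And>f. 0 \<le> x $ f" and le: "\<And>f. f \<in> G \<Longrightarrow> x $ f \<le> x $ top"
    and t: "top \<in> G"
  shows "Delta0 G x \<in> causal_cone G"
proof -
  have "0 \<le> causal_form G g (Delta0 G x)" if "g \<in> G" for g
  proof -
    have "(\<Sum>f\<in>{f\<in>G. g < f \<and> f < top}. pco f (Delta0 G x) - mco f (Delta0 G x)) = 0"
      by (intro sum.neutral) (auto simp: pco_Delta0 mco_Delta0)
    then show ?thesis using le[OF that] pos t unfolding causal_form_def by (simp add: pco_Delta0 mco_Delta0)
  qed
  moreover have "Delta0 G x \<in> coord_space G \<times> coord_space G"
    using pco_Delta0[of _ G x] mco_Delta0[of _ G x]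
    by (auto simp: coord_space_def mem_Times_iff pco_def mco_def)
  ultimately show ?thesis using pos by (auto simp: causal_cone_def pco_Delta0 mco_Delta0)
qed

lemma convex_causal_cone: "convex (causal_cone G)"
proof -
  have linF: "linear (causal_form G g)" for g
    unfolding causal_form_def[abs_def]
    by (intro linear_compose_add linear_compose_sub linear_compose_sum ballI linear_pco linear_mco)
  show ?thesis
    by (rule convexI)
      (auto simp: causal_cone_def coord_space_def mem_Times_iff pco_simps mco_simps
        linear_add[OF linF] linear_scale[OF linF] intro!: add_nonneg_nonneg mult_nonneg_nonneg)
qed

lemma Union_universe_fan:
  "\<Union>(universe_fan G) = (\<Union>N\<in>{N. nested G N}. nested_cone N) \<inter> causal_cone G"
proof (intro subset_antisym subsetI)
  fix v assume "v \<in> \<Union>(universe_fan G)"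
  then obtain F C where "v \<in> F" "F face_of C \<inter> causal_cone G" "C \<in> Sigma_fan G"
    unfolding universe_fan_def all_faces_def by auto
  moreover from this obtain N where "nested G N" "C face_of nested_cone N"
    unfolding Sigma_fan_def all_faces_def by auto
  ultimately show "v \<in> (\<Union>N\<in>{N. nested G N}. nested_cone N) \<inter> causal_cone G"
    by (blast dest: face_of_imp_subset)
next
  fix v assume "v \<in> (\<Union>N\<in>{N. nested G N}. nested_cone N) \<inter> causal_cone G"
  then obtain N where N: "nested G N" and v: "v \<in> nested_cone N \<inter> causal_cone G" by auto
  have "nested_cone N \<in> Sigma_fan G"
    using N v face_of_refl[OF convex_nested_cone[of N]] unfolding Sigma_fan_def all_faces_def by blast
  moreover have "nested_cone N \<inter> causal_cone G face_of nested_cone N \<inter> causal_cone G"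
    by (intro face_of_refl convex_Int convex_nested_cone convex_causal_cone)
  ultimately have "nested_cone N \<inter> causal_cone G \<in> universe_fan G"
    using v unfolding universe_fan_def all_faces_def by blast
  then show "v \<in> \<Union>(universe_fan G)" using v by blast
qed

text \<open>
A cone \<open>C\<close> of the refinement lies in a chamber whose ranking puts \<open>top\<close> first, since the causal
inequalities make \<open>\<lambda>\<close> smallest there.  The diagonal point of this ranking is then
in the support of the universe fan, so the refinement has a cone \<open>W\<close> through it.  Being a face of
the chamber, \<open>W\<close> contains all points of the chamber with \<open>m\<^bsub>top\<^esub> = 0\<close>, in particular \<open>C\<close>.
\<close>

lemma bij_betw_maximal_cones_universe:
  fixes G :: "'a::{finite,complete_lattice} set"
  assumes at: "atomic_lattice TYPE('a)" and bs: "building_set G"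
    and "lightcone_refinement_universe G \<Gamma>"
  shows "bij_betw (proj_cone G) (maximal_elements \<Gamma>) (maximal_elements (proj_cone G ` \<Gamma>))"
proof -
  obtain B where ch: "lightcone_choice G B"
    and \<Gamma>: "\<Gamma> = {C \<in> lightcone_fan G B. C \<subseteq> \<Union>(universe_fan G)}" and ref: "refines \<Gamma> (universe_fan G)"
    using assms(3) by (auto simp: lightcone_refinement_universe_def lightcone_refinement_Sigma_def)
  show ?thesis
  proof (rule bij_betw_maximal_cones[OF at bs])
    fix C assume C: "C \<in> \<Gamma>"
    then show "\<exists>N. nested G N \<and> C \<subseteq> nested_cone N" unfolding \<Gamma> by (blast intro: lightcone_fan_in_nested_cone)
    have causal: "D \<subseteq> causal_cone G" if "D \<in> \<Gamma>" for D
      using that Union_universe_fan[of G] by (auto simp: \<Gamma>)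
    from C have "C \<in> lightcone_fan G B" by (simp add: \<Gamma>)
    from lightcone_fan_subset_chamber[OF bs ch this]
    obtain N r where N: "nested G N" "\<And>M. nested G M \<Longrightarrow> N \<subseteq> M \<Longrightarrow> M = N"
      and r: "inj r" "\<And>e. 0 < r e" and sub: "C \<subseteq> chamber N (B N) r"
      and top_max: "(\<And>v e. v \<in> C \<Longrightarrow> e \<in> N \<Longrightarrow> lambda_form N top v \<le> lambda_form N e v)
        \<Longrightarrow> \<forall>e\<in>N. r e \<le> r top"
      by metis
    have NG: "N \<subseteq> G" using N(1) by (rule nested_imp_subset)
    have t: "top \<in> N" using N(2)[OF nested_insert_top[OF bs N(1)]] by blast
    have "lambda_form N top v \<le> lambda_form N e v" if v: "v \<in> C" and e: "e \<in> N" for v e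
    proof (cases "e = top")
      case False
      have "v \<in> nested_cone N" using sub v by (auto simp: chamber_def)
      then have "causal_form G e v = lambda_form N e v - lambda_form N top v"
        by (rule causal_form_lambda[OF bs N(1) t e False])
      moreover have "0 \<le> causal_form G e v"
        using causal[OF C] v e NG by (auto simp: causal_cone_def)
      ultimately show ?thesis by simp
    qed simp
    then have rt: "\<forall>e\<in>N. r e \<le> r top" by (rule top_max)
    define x where "x = ranking_point N r"
    have x: "x \<in> coord_space G" unfolding x_def by (rule ranking_point_coord_space[OF NG])
    have xch: "Delta0 G x \<in> chamber N (B N) r"
      unfolding x_def
      by (rule ranking_point_in_chamber[OF bs N(1)]) (use lightcone_choiceD(1)[OF ch N(1)] r in auto)
    have "Delta0 G x \<in> causal_cone G"
    proof (rule Delta0_causal[OF x])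
      show "0 \<le> x $ f" for f using r(2)[of f] by (simp add: x_def ranking_point_def)
      show "x $ f \<le> x $ top" for f
        using rt t r(2)[of top] by (simp add: x_def ranking_point_def)
      show "top \<in> G" using t NG by blast
    qed
    moreover have "Delta0 G x \<in> nested_cone N" using xch by (simp add: chamber_def)
    ultimately have "Delta0 G x \<in> \<Union>(universe_fan G)" using N(1) unfolding Union_universe_fan by blast
    then have "Delta0 G x \<in> \<Union>\<Gamma>" using ref by (simp add: refines_def)
    then obtain W where W: "W \<in> \<Gamma>" "Delta0 G x \<in> W" by blast
    have face: "D face_of chamber N (B N) r" if "D \<in> \<Gamma>" "Delta0 G x \<in> D" for D
      using fan_cone_at_ranking_point[OF bs ch N r] that unfolding x_def \<Gamma> by blast
    have all: "D \<subseteq> W" if "D \<in> \<Gamma>" "D \<subseteq> chamber N (B N) r" for D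
    proof
      fix v assume v: "v \<in> D"
      then have "mco top v = 0" using causal[OF that(1)] by (auto simp: causal_cone_def)
      then show "v \<in> W"
        using ranking_point_relative_interior[OF bs N(1) _ r face[OF W, unfolded x_def] W(2)[unfolded x_def]]
          v that(2) lightcone_choiceD(1)[OF ch N(1)] by blast
    qed
    have "D \<subseteq> W" if "D \<in> \<Gamma>" "Delta0 G x \<in> D" for D
      using all[OF that(1) face_of_imp_subset[OF face[OF that]]] .
    then show "\<exists>W\<in>\<Gamma>. C \<subseteq> W \<and>
      (\<exists>x\<in>coord_space G. Delta0 G x \<in> W \<and> (\<forall>D\<in>\<Gamma>. Delta0 G x \<in> D \<longrightarrow> D \<subseteq> W))"
      using all[OF C sub] W x by blast
  qed
qed

theorem proposition6p3:
  fixes G :: "'a::{finite,complete_lattice} set"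
  assumes "atomic_lattice TYPE('a)"
    and "building_set G"
  shows "(\<forall>\<Gamma>. lightcone_refinement_Sigma G \<Gamma> \<longrightarrow>
            bij_betw (proj_cone G) (maximal_elements \<Gamma>) (maximal_elements (proj_cone G ` \<Gamma>))) \<and>
         (\<forall>\<Gamma>. lightcone_refinement_universe G \<Gamma> \<longrightarrow>
            bij_betw (proj_cone G) (maximal_elements \<Gamma>) (maximal_elements (proj_cone G ` \<Gamma>)))"
  using bij_betw_maximal_cones_Sigma[OF assms] bij_betw_maximal_cones_universe[OF assms] by blast

end
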